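(* Let $\phi\in\mathrm{Rat}(\mathbb{U})$ have degree $d$. (a) If $\phi$ is outer regular, then $\phi_e^{-1}$ has $d$ distinct branches $\sigma_1,\dots,\sigma_d$ that are holomorphic on $\mathbb{U}$ and map $\mathbb{U}$ into $\mathbb{U}$, the functions $h_j(z)=z\sigma_j'(z)$ are bounded and holomorphic on $\mathbb{U}$, all operators below are bounded on $H^2$, and $$C_\phi^*=\Lambda_0+\sum_{j=1}^d M_{h_j}C_{\sigma_j}B \quad\text{on } H^2.$$ (b) If, in addition, $\phi$ is strongly outer regular, then moreover $\Lambda_\infty$ is a bounded operator on $H^2$, the functions $g_j(z)=z\sigma_j'(z)/\sigma_j(z)$ are bounded and holomorphic on $\mathbb{U}$, and $$C_\phi^*=\Lambda_\infty+\sum_{j=1}^d M_{g_j}C_{\sigma_j}\quad\text{on } H^2,$$ with all operators on the right bounded on $H^2$.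
   Context: $\mathbb{U}$ is the open unit disc, $\hat{\mathbb{C}}$ the Riemann sphere. $\mathrm{Rat}(\mathbb{U})$ is the set of rational functions mapping $\mathbb{U}$ into itself, regarded as maps $\hat{\mathbb{C}}\to\hat{\mathbb{C}}$; the degree of $p/q$ (relatively prime polynomials) is $\max(\deg p,\deg q)$. $\rho(z)=1/\overline z$ and $\phi_e:=\rho\circ\phi\circ\rho$. A point $w$ is a regular value of a rational function $R$ of degree $d$ if $R^{-1}(\{w\})$ consists of $d$ distinct points, otherwise a critical value; a branch of $R^{-1}$ on an open set $\Omega$ is a holomorphic $\sigma$ on $\Omega$ with $R\circ\sigma=\mathrm{id}_\Omega$. $\phi$ is outer regular if all its critical values lie in $\mathbb{U}$ (every point of $\{|z|\ge1\}\cup\{\infty\}$ is a regular value of $\phi$), and strongly outer regular if in addition $\phi(\infty)\in\mathbb{U}$. $H^2$ is the Hardy space on $\mathbb{U}$ (holomorphic $f=\sum\hat f(n)z^n$ with $\sum|\hat f(n)|^2<\infty$), $C_\psi f=f\circ\psi$, $C_\phi^*$ is the adjoint of $C_\phi$ on $H^2$, $M_g f=gf$, $B$ is the backward shift $(Bf)(z)=(f(z)-f(0))/z$ ($z\ne0$), $(Bf)(0)=f'(0)$. $\Lambda_0 f(z)=f(0)/(1-\overline{\phi(0)}z)$ and $\Lambda_\infty f(z)=f(0)/(1-\overline{\phi(\infty)}z)$. *)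

theory Defs
  imports "HOL-Complex_Analysis.Complex_Analysis" "HOL-Computational_Algebra.Polynomial"
begin

abbreviation UD :: "complex set" where "UD \<equiv> ball 0 1"

text \<open>The Riemann sphere is modelled as complex option, None being the point at infinity.\<close>

definition rho :: "complex option \<Rightarrow> complex option" where
  "rho w = (case w of None \<Rightarrow> Some 0
                    | Some z \<Rightarrow> (if z = 0 then None else Some (1 / cnj z)))"

text \<open>The rational map p/q (p, q coprime, q nonzero) as a map of the Riemann sphere.\<close>
definition rat_eval :: "complex poly \<Rightarrow> complex poly \<Rightarrow> complex option \<Rightarrow> complex option" where
  "rat_eval p q w = (case w of
      None \<Rightarrow> (if degree p > degree q then None
               else if degree p = degree q then Some (lead_coeff p / lead_coeff q)
               else Some 0)
    | Some z \<Rightarrow> (if poly q z = 0 then None else Some (poly p z / poly q z)))"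

definition rat_degree :: "complex poly \<Rightarrow> complex poly \<Rightarrow> nat" where
  "rat_degree p q = max (degree p) (degree q)"

definition in_Rat_U :: "complex poly \<Rightarrow> complex poly \<Rightarrow> bool" where
  "in_Rat_U p q \<longleftrightarrow> q \<noteq> 0 \<and> coprime p q \<and>
     (\<forall>z\<in>UD. rat_eval p q (Some z) \<in> Some ` UD)"

definition rat_ext :: "complex poly \<Rightarrow> complex poly \<Rightarrow> complex option \<Rightarrow> complex option" where
  "rat_ext p q = rho \<circ> rat_eval p q \<circ> rho"

definition regular_value :: "complex poly \<Rightarrow> complex poly \<Rightarrow> complex option \<Rightarrow> bool" where
  "regular_value p q w \<longleftrightarrow> finite {x. rat_eval p q x = w} \<and>
      card {x. rat_eval p q x = w} = rat_degree p q"

definition outer_regular :: "complex poly \<Rightarrow> complex poly \<Rightarrow> bool" where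
  "outer_regular p q \<longleftrightarrow> regular_value p q None \<and>
      (\<forall>w. 1 \<le> norm w \<longrightarrow> regular_value p q (Some w))"

definition strongly_outer_regular :: "complex poly \<Rightarrow> complex poly \<Rightarrow> bool" where
  "strongly_outer_regular p q \<longleftrightarrow> outer_regular p q \<and> rat_eval p q None \<in> Some ` UD"

definition is_branch_inv :: "(complex option \<Rightarrow> complex option) \<Rightarrow> complex set \<Rightarrow> (complex \<Rightarrow> complex) \<Rightarrow> bool" where
  "is_branch_inv R \<Omega> \<sigma> \<longleftrightarrow> \<sigma> holomorphic_on \<Omega> \<and> (\<forall>z\<in>\<Omega>. R (Some (\<sigma> z)) = Some z)"

definition hcoef :: "(complex \<Rightarrow> complex) \<Rightarrow> nat \<Rightarrow> complex" where
  "hcoef f n = (deriv ^^ n) f 0 / of_nat (fact n)"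

definition H2 :: "(complex \<Rightarrow> complex) set" where
  "H2 = {f. f holomorphic_on UD \<and> summable (\<lambda>n. (norm (hcoef f n))\<^sup>2)}"

definition h2_inner :: "(complex \<Rightarrow> complex) \<Rightarrow> (complex \<Rightarrow> complex) \<Rightarrow> complex" where
  "h2_inner f g = (\<Sum>n. hcoef f n * cnj (hcoef g n))"

definition h2_norm :: "(complex \<Rightarrow> complex) \<Rightarrow> real" where
  "h2_norm f = sqrt (\<Sum>n. (norm (hcoef f n))\<^sup>2)"

definition bounded_H2_op :: "((complex \<Rightarrow> complex) \<Rightarrow> (complex \<Rightarrow> complex)) \<Rightarrow> bool" where
  "bounded_H2_op T \<longleftrightarrow>
     (\<forall>f\<in>H2. T f \<in> H2) \<and>
     (\<forall>f\<in>H2. \<forall>g\<in>H2. \<forall>a b. \<forall>z\<in>UD.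
         T (\<lambda>w. a * f w + b * g w) z = a * T f z + b * T g z) \<and>
     (\<exists>C. \<forall>f\<in>H2. h2_norm (T f) \<le> C * h2_norm f)"

definition is_H2_adjoint :: "((complex \<Rightarrow> complex) \<Rightarrow> (complex \<Rightarrow> complex)) \<Rightarrow> ((complex \<Rightarrow> complex) \<Rightarrow> (complex \<Rightarrow> complex)) \<Rightarrow> bool" where
  "is_H2_adjoint T S \<longleftrightarrow> (\<forall>f\<in>H2. \<forall>g\<in>H2. h2_inner (S f) g = h2_inner f (T g))"

definition comp_op :: "(complex \<Rightarrow> complex) \<Rightarrow> (complex \<Rightarrow> complex) \<Rightarrow> (complex \<Rightarrow> complex)" where
  "comp_op \<psi> f = f \<circ> \<psi>"

definition mult_op :: "(complex \<Rightarrow> complex) \<Rightarrow> (complex \<Rightarrow> complex) \<Rightarrow> (complex \<Rightarrow> complex)" where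
  "mult_op g f = (\<lambda>z. g z * f z)"

definition bshift :: "(complex \<Rightarrow> complex) \<Rightarrow> (complex \<Rightarrow> complex)" where
  "bshift f = (\<lambda>z. if z = 0 then deriv f 0 else (f z - f 0) / z)"

text \<open>phi restricted to finite points (used on the disc, where q has no zeros).\<close>
definition rat_fun :: "complex poly \<Rightarrow> complex poly \<Rightarrow> complex \<Rightarrow> complex" where
  "rat_fun p q z = poly p z / poly q z"

definition Lambda_op :: "complex \<Rightarrow> (complex \<Rightarrow> complex) \<Rightarrow> (complex \<Rightarrow> complex)" where
  "Lambda_op c f = (\<lambda>z. f 0 / (1 - cnj c * z))"

definition Lambda0 :: "complex poly \<Rightarrow> complex poly \<Rightarrow> (complex \<Rightarrow> complex) \<Rightarrow> (complex \<Rightarrow> complex)" where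
  "Lambda0 p q = Lambda_op (rat_fun p q 0)"

definition LambdaInf :: "complex poly \<Rightarrow> complex poly \<Rightarrow> (complex \<Rightarrow> complex) \<Rightarrow> (complex \<Rightarrow> complex)" where
  "LambdaInf p q = Lambda_op (the (rat_eval p q None))"

end

theory Submission
  imports Defs
begin

text \<open>
  On the unit circle \<open>cnj \<phi> = 1 / \<phi>\<^sub>e\<close>, so the adjoint of the composition operator is computed by
  decomposing \<open>k\<^sub>w \<circ> \<phi>\<close>, with \<open>k\<^sub>w(z) = 1 / (1 - cnj w * z)\<close> the reproducing kernel, into partial
  fractions. Writing \<open>\<phi>\<^sub>e = P / R\<close> with conjugate-reversed polynomials, the polynomial
  \<open>A\<^sub>w = P - w R\<close> has degree \<open>d\<close> for every \<open>w\<close> in the closed disc, and outer regularity says that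
  its roots are distinct; they are the values \<open>\<sigma>\<^sub>j(w)\<close>. Constant fibre cardinality makes \<open>\<phi>\<^sub>e\<close> a
  covering over the disc, whose sections are the branches, and differentiating \<open>A\<^sub>w(\<sigma>\<^sub>j(w)) = 0\<close>
  identifies the residues of \<open>P / A\<^sub>w\<close> with \<open>w \<sigma>\<^sub>j'(w)\<close>. The constant term of the partial fraction
  expansion produces \<open>\<Lambda>\<^sub>0\<close>; evaluating the expansion at \<open>0\<close> turns \<open>\<Lambda>\<^sub>0\<close> into \<open>\<Lambda>\<^sub>\<infinity>\<close>.

  All operators except the backward shift are weighted composition operators \<open>f \<mapsto> g \<cdot> (f \<circ> \<psi>)\<close>.
  Their boundedness follows from a harmonic majorant \<open>Re F\<close> of \<open>|f|\<^sup>2\<close>, since the mean of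
  \<open>Re F \<circ> \<psi>\<close> over a circle is \<open>Re F(\<psi>(0))\<close>.
\<close>

subsection \<open>Taylor coefficients\<close>

lemma hcoef_cong:
  assumes "\<And>z. z \<in> UD \<Longrightarrow> f z = g z"
  shows "hcoef f n = hcoef g n"
proof -
  have "eventually (\<lambda>z. f z = g z) (nhds 0)"
    using eventually_nhds_in_open[of UD 0] assms by (auto elim: eventually_mono)
  then show ?thesis
    unfolding hcoef_def by (metis higher_deriv_cong_ev)
qed

lemma hcoef_sums:
  assumes "f holomorphic_on UD" "z \<in> UD"
  shows "(\<lambda>n. hcoef f n * z ^ n) sums f z"
  using holomorphic_power_series[OF assms] by (simp add: hcoef_def)

text \<open>Convergence at the single point 1/2 already gives a positive radius of convergence, so
  the \<open>a n\<close> form the power series expansion of \<open>f\<close> at 0, and that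
  expansion is unique.\<close>

lemma hcoef_unique:
  assumes "\<And>z. z \<in> UD \<Longrightarrow> (\<lambda>n. a n * z ^ n) sums f z"
  shows "hcoef f n = a n"
proof -
  have "summable (\<lambda>n. a n * (1 / 2) ^ n)"
    using assms[of "1 / 2"] by (auto dest: sums_summable)
  from conv_radius_geI[OF this] have "ereal (1 / 2) \<le> conv_radius a"
    by simp
  then have "fps_conv_radius (Abs_fps a) > 0"
    unfolding fps_conv_radius_def by (auto intro: less_le_trans[of 0 "ereal (1 / 2)"])
  moreover have "eventually (\<lambda>z. eval_fps (Abs_fps a) z = f z) (nhds 0)"
    using eventually_nhds_in_open[of UD 0]
    by (rule eventually_mono) (use assms in \<open>auto simp: eval_fps_def sums_iff\<close>)
  ultimately have "f has_fps_expansion Abs_fps a"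
    by (simp add: has_fps_expansion_def)
  then show ?thesis
    using fps_nth_fps_expansion[of f "Abs_fps a" n] by (simp add: hcoef_def)
qed

lemma hcoef_lincomb:
  assumes "f holomorphic_on UD" "g holomorphic_on UD"
  shows "hcoef (\<lambda>z. a * f z + b * g z) n = a * hcoef f n + b * hcoef g n"
proof (rule hcoef_unique)
  fix z :: complex assume "z \<in> UD"
  then have "(\<lambda>n. a * (hcoef f n * z ^ n) + b * (hcoef g n * z ^ n)) sums (a * f z + b * g z)"
    by (intro sums_add sums_mult hcoef_sums assms)
  then show "(\<lambda>n. (a * hcoef f n + b * hcoef g n) * z ^ n) sums (a * f z + b * g z)"
    by (simp add: algebra_simps)
qed

lemma hcoef_polynomial:
  "hcoef (\<lambda>z. \<Sum>n<N. a n * z ^ n) k = (if k < N then a k else 0)"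
proof (rule hcoef_unique)
  fix z :: complex
  have "(\<lambda>n. if n \<in> {..<N} then a n * z ^ n else 0) sums (\<Sum>n<N. a n * z ^ n)"
    by (rule sums_If_finite_set) simp
  then show "(\<lambda>n. (if n < N then a n else 0) * z ^ n) sums (\<Sum>n<N. a n * z ^ n)"
    by (rule sums_cong[THEN iffD1, rotated]) auto
qed

lemma hcoef_monomial: "hcoef (\<lambda>z. z ^ n) k = (if k = n then 1 else 0)"
proof (rule hcoef_unique)
  fix z :: complex
  show "(\<lambda>k. (if k = n then 1 else 0) * z ^ k) sums (z ^ n)"
    using sums_single[of n "\<lambda>k. z ^ k"] by (rule sums_cong[THEN iffD1, rotated]) auto
qed

lemma hcoef_geometric:
  assumes "c \<in> UD"
  shows "hcoef (\<lambda>z. 1 / (1 - c * z)) n = c ^ n"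
proof (rule hcoef_unique)
  fix z :: complex assume "z \<in> UD"
  then have "norm (c * z) < 1"
    using assms mult_strict_mono[of "norm c" 1 "norm z" 1] by (simp add: norm_mult)
  then show "(\<lambda>n. c ^ n * z ^ n) sums (1 / (1 - c * z))"
    using geometric_sums[of "c * z"] by (simp add: power_mult_distrib)
qed

subsection \<open>Means over circles\<close>

text \<open>Cauchy's formula for the n-th derivative on the circle of radius r. There
  \<open>cnj c = r^2 / c\<close>, so the Cauchy kernel becomes a multiple of
  \<open>cnj c ^ n\<close> and the contour integral an ordinary mean over [0, 1].\<close>

lemma circle_mean_hcoef:
  assumes hol: "h holomorphic_on UD" and r: "0 < r" "r < 1"
  shows "((\<lambda>t. h (circlepath 0 r t) * cnj (circlepath 0 r t) ^ n) has_integral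
           of_real (r ^ (2 * n)) * hcoef h n) {0..1}"
proof -
  have sub: "cball 0 r \<subseteq> UD" using r by auto
  have "((\<lambda>u. h u / (u - 0) ^ Suc n) has_contour_integral
      (2 * pi * \<i>) / fact n * (deriv ^^ n) h 0) (circlepath 0 r)"
    using r holomorphic_on_subset[OF hol sub]
    by (intro Cauchy_has_contour_integral_higher_derivative_circlepath)
       (auto intro: holomorphic_on_imp_continuous_on holomorphic_on_subset)
  then have "((\<lambda>t. h (circlepath 0 r t) / circlepath 0 r t ^ Suc n *
       vector_derivative (circlepath 0 r) (at t within {0..1}))
       has_integral 2 * pi * \<i> * hcoef h n) {0..1}"
    by (simp add: has_contour_integral_def hcoef_def del: power_Suc)
  from has_integral_mult_right[OF this, of "of_real (r ^ (2 * n)) / (2 * pi * \<i>)"]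
  have "((\<lambda>t. of_real (r ^ (2 * n)) / (2 * pi * \<i>) * (h (circlepath 0 r t) / circlepath 0 r t ^ Suc n *
       vector_derivative (circlepath 0 r) (at t within {0..1})))
       has_integral of_real (r ^ (2 * n)) * hcoef h n) {0..1}"
    by (rule has_integral_eq_rhs) (simp add: field_simps)
  then show ?thesis
  proof (rule has_integral_cong[THEN iffD1, rotated])
    fix t :: real assume t: "t \<in> {0..1}"
    define c where "c = circlepath 0 r t"
    have c0: "c \<noteq> 0" and cr: "norm c = r"
      using r by (auto simp: c_def circlepath norm_mult)
    have vd: "vector_derivative (circlepath 0 r) (at t within {0..1}) = 2 * pi * \<i> * c"
      using vector_derivative_circlepath01[of t 0 r] t by (simp add: c_def) (simp add: circlepath)
    have "cnj c = of_real (r ^ 2) / c"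
      using c0 cr complex_norm_square[of c] by (simp add: field_simps)
    then have "cnj c ^ n = of_real (r ^ (2 * n)) / c ^ n"
      by (simp add: power_divide power_mult)
    then show "of_real (r ^ (2 * n)) / (2 * pi * \<i>) * (h (circlepath 0 r t) / circlepath 0 r t ^ Suc n *
       vector_derivative (circlepath 0 r) (at t within {0..1})) =
       h (circlepath 0 r t) * cnj (circlepath 0 r t) ^ n"
      using c0 unfolding vd c_def[symmetric] by (simp add: field_simps)
  qed
qed

lemma circle_mean_holomorphic:
  assumes "h holomorphic_on UD" "0 < r" "r < 1"
  shows "((\<lambda>t. h (circlepath 0 r t)) has_integral h 0) {0..1}"
  using circle_mean_hcoef[OF assms, of 0] by (simp add: hcoef_def)

lemma circlepath_in_UD: "0 < r \<Longrightarrow> r < 1 \<Longrightarrow> circlepath 0 r t \<in> UD"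
  by (simp add: circlepath norm_mult)

text \<open>Bessel's inequality: the mean of |h - s|^2 is nonnegative for the Taylor section
  \<open>s\<close>, and the means of h * cnj s and of s * cnj s both equal the sum on the
  left.\<close>

lemma circle_bessel:
  assumes hol: "h holomorphic_on UD" and r: "0 < r" "r < 1"
    and I: "((\<lambda>t. (norm (h (circlepath 0 r t)))\<^sup>2) has_integral I) {0..1}"
  shows "(\<Sum>n<N. (norm (hcoef h n))\<^sup>2 * r ^ (2 * n)) \<le> I"
proof -
  define s where "s z = (\<Sum>n<N. hcoef h n * z ^ n)" for z
  define S where "S = (\<Sum>n<N. (norm (hcoef h n))\<^sup>2 * r ^ (2 * n))"
  let ?c = "circlepath 0 r"
  \<comment> \<open>Stated for every \<open>g\<close> that shares its first \<open>N\<close>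
    coefficients with \<open>h\<close>, so that it applies to \<open>h\<close> and to
    \<open>s\<close> itself.\<close>
  have mean: "((\<lambda>t. g (?c t) * cnj (s (?c t))) has_integral of_real S) {0..1}"
    if "g holomorphic_on UD" "\<And>n. n < N \<Longrightarrow> hcoef g n = hcoef h n" for g
  proof -
    have "((\<lambda>t. \<Sum>n<N. cnj (hcoef h n) * (g (?c t) * cnj (?c t) ^ n)) has_integral
        (\<Sum>n<N. cnj (hcoef h n) * (of_real (r ^ (2 * n)) * hcoef g n))) {0..1}"
      by (intro has_integral_sum has_integral_mult_right circle_mean_hcoef that r finite_lessThan)
    moreover have "(\<Sum>n<N. cnj (hcoef h n) * (of_real (r ^ (2 * n)) * hcoef g n)) = of_real S"
      unfolding S_def of_real_sum
      by (intro sum.cong refl) (simp add: that complex_norm_square[symmetric] mult_ac flip: of_real_power)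
    moreover have "(\<Sum>n<N. cnj (hcoef h n) * (g z * cnj z ^ n)) = g z * cnj (s z)" for z
      by (simp add: s_def sum_distrib_left mult_ac)
    ultimately show ?thesis by simp
  qed
  have sh: "s holomorphic_on UD"
    unfolding s_def by (intro holomorphic_intros)
  have hs: "((\<lambda>t. Re (h (?c t) * cnj (s (?c t)))) has_integral S) {0..1}"
    using has_integral_linear[OF mean[OF hol refl] bounded_linear_Re] by (simp add: o_def)
  have ss: "((\<lambda>t. Re (s (?c t) * cnj (s (?c t)))) has_integral S) {0..1}"
    using has_integral_linear[OF mean[OF sh] bounded_linear_Re]
    by (simp add: o_def s_def[abs_def] hcoef_polynomial)
  have "((\<lambda>t. (norm (h (?c t)))\<^sup>2 - 2 * Re (h (?c t) * cnj (s (?c t))) + Re (s (?c t) * cnj (s (?c t))))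
      has_integral I - 2 * S + S) {0..1}"
    by (intro has_integral_add has_integral_diff I ss has_integral_mult_right[OF hs])
  moreover have "0 \<le> (norm u)\<^sup>2 - 2 * Re (u * cnj v) + Re (v * cnj v)" for u v :: complex
  proof -
    have "(norm u)\<^sup>2 - 2 * Re (u * cnj v) + Re (v * cnj v) = (norm (u - v))\<^sup>2"
      unfolding cmod_power2 by (simp add: power2_eq_square algebra_simps)
    then show ?thesis by simp
  qed
  ultimately have "0 \<le> I - 2 * S + S"
    by (rule has_integral_nonneg)
  then show ?thesis by (simp add: S_def)
qed

subsection \<open>Weighted composition operators\<close>

text \<open>Split f = a 0 + z g and expand |f|^2. Replacing |z g|^2 by |g|^2 leaves the real part of
  a holomorphic function plus |g|^2, which the induction majorizes. The upper bound on
  \<open>Re (F z)\<close> serves to control it at the single point \<psi>(0).\<close>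

lemma polynomial_square_majorant:
  fixes a :: "nat \<Rightarrow> complex"
  shows "\<exists>F. F holomorphic_on UNIV \<and>
    (\<forall>z\<in>UD. (norm (\<Sum>n<N. a n * z ^ n))\<^sup>2 \<le> Re (F z)) \<and>
    (\<forall>z\<in>UD. Re (F z) \<le>
      (\<Sum>n<N. (norm (a n))\<^sup>2 * (1 / (1 - norm z) + (\<Sum>k=1..n. norm z ^ k))))"
proof (induction N arbitrary: a)
  case 0
  show ?case by (rule exI[of _ "\<lambda>_. 0"]) auto
next
  case (Suc N)
  define g where "g z = (\<Sum>n<N. a (Suc n) * z ^ n)" for z
  have f_eq: "(\<Sum>n<Suc N. a n * z ^ n) = a 0 + z * g z" for z
    unfolding g_def sum.lessThan_Suc_shift by (simp add: sum_distrib_left mult_ac)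
  obtain G where G: "G holomorphic_on UNIV"
    and Gge: "\<And>z. z \<in> UD \<Longrightarrow> (norm (g z))\<^sup>2 \<le> Re (G z)"
    and Gle: "\<And>z. z \<in> UD \<Longrightarrow> Re (G z) \<le>
      (\<Sum>n<N. (norm (a (Suc n)))\<^sup>2 * (1 / (1 - norm z) + (\<Sum>k=1..n. norm z ^ k)))"
    using Suc.IH[of "\<lambda>n. a (Suc n)"] unfolding g_def by blast
  define F where "F z = of_real ((norm (a 0))\<^sup>2) + 2 * (cnj (a 0) * (z * g z)) + G z" for z
  have "F holomorphic_on UNIV"
    unfolding F_def g_def by (intro holomorphic_intros G)
  moreover have "(norm (\<Sum>n<Suc N. a n * z ^ n))\<^sup>2 \<le> Re (F z)" if z: "z \<in> UD" for z
  proof -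
    have "(norm (a 0 + z * g z))\<^sup>2 =
        (norm (a 0))\<^sup>2 + 2 * Re (cnj (a 0) * (z * g z)) + (norm (z * g z))\<^sup>2"
      unfolding cmod_power2 by (simp add: power2_eq_square algebra_simps)
    also have "(norm (z * g z))\<^sup>2 \<le> (norm (g z))\<^sup>2"
      using z by (intro power_mono) (auto simp: norm_mult mult_left_le_one_le)
    finally show ?thesis
      using Gge[OF z] unfolding f_eq F_def by simp
  qed
  moreover have "Re (F z) \<le>
      (\<Sum>n<Suc N. (norm (a n))\<^sup>2 * (1 / (1 - norm z) + (\<Sum>k=1..n. norm z ^ k)))"
    if z: "z \<in> UD" for z
  proof -
    define \<rho> where "\<rho> = norm z"
    have \<rho>: "0 \<le> \<rho>" "\<rho> < 1" using z by (auto simp: \<rho>_def)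
    have "2 * Re (cnj (a 0) * (z * g z)) \<le> 2 * (norm (a 0) * norm (z * g z))"
      using complex_Re_le_cmod[of "cnj (a 0) * (z * g z)"] by (simp add: norm_mult)
    also have "norm (z * g z) \<le> (\<Sum>n<N. norm (a (Suc n)) * \<rho> ^ Suc n)"
      unfolding g_def sum_distrib_left \<rho>_def
      by (rule sum_norm_le) (simp add: norm_mult norm_power mult_ac)
    finally have "2 * Re (cnj (a 0) * (z * g z)) \<le>
        (\<Sum>n<N. 2 * (norm (a 0) * (norm (a (Suc n)) * \<rho> ^ Suc n)))"
      by (simp add: mult_left_mono sum_distrib_left)
    \<comment> \<open>The inequality 2xy \<le> x^2 + y^2 shares each cross term: the part of
      \<open>a 0\<close> collects a geometric sum, and the part of \<open>a (Suc n)\<close>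
      lengthens its own sum by the power \<open>Suc n\<close>.\<close>
    also have "\<dots> \<le> (\<Sum>n<N. ((norm (a 0))\<^sup>2 + (norm (a (Suc n)))\<^sup>2) * \<rho> ^ Suc n)"
    proof (rule sum_mono)
      fix n
      have "2 * (norm (a 0) * norm (a (Suc n))) \<le> (norm (a 0))\<^sup>2 + (norm (a (Suc n)))\<^sup>2"
        using sum_squares_bound[of "norm (a 0)" "norm (a (Suc n))"] by (simp add: mult_ac)
      from mult_right_mono[OF this, of "\<rho> ^ Suc n"] \<rho>
      show "2 * (norm (a 0) * (norm (a (Suc n)) * \<rho> ^ Suc n)) \<le>
          ((norm (a 0))\<^sup>2 + (norm (a (Suc n)))\<^sup>2) * \<rho> ^ Suc n"
        by (simp add: mult_ac)
    qed
    also have "\<dots> = (norm (a 0))\<^sup>2 * (\<Sum>n<N. \<rho> ^ Suc n) + (\<Sum>n<N. (norm (a (Suc n)))\<^sup>2 * \<rho> ^ Suc n)"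
      by (simp only: distrib_right sum.distrib sum_distrib_left)
    finally have 1: "2 * Re (cnj (a 0) * (z * g z)) \<le>
       (norm (a 0))\<^sup>2 * (\<Sum>n<N. \<rho> ^ Suc n) + (\<Sum>n<N. (norm (a (Suc n)))\<^sup>2 * \<rho> ^ Suc n)" .
    have "1 + (\<Sum>n<N. \<rho> ^ Suc n) = (\<Sum>n<Suc N. \<rho> ^ n)"
      unfolding sum.lessThan_Suc_shift by simp
    also have "\<dots> \<le> 1 / (1 - \<rho>)"
      using \<rho> by (simp add: sum_gp_strict divide_right_mono del: sum.lessThan_Suc)
    finally have "(norm (a 0))\<^sup>2 + (norm (a 0))\<^sup>2 * (\<Sum>n<N. \<rho> ^ Suc n) \<le> (norm (a 0))\<^sup>2 * (1 / (1 - \<rho>))"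
      using mult_left_mono[of "1 + (\<Sum>n<N. \<rho> ^ Suc n)" "1 / (1 - \<rho>)" "(norm (a 0))\<^sup>2"]
      by (simp add: distrib_left)
    moreover have "(\<Sum>n<Suc N. (norm (a n))\<^sup>2 * (1 / (1 - \<rho>) + (\<Sum>k=1..n. \<rho> ^ k))) =
       (norm (a 0))\<^sup>2 * (1 / (1 - \<rho>)) +
       ((\<Sum>n<N. (norm (a (Suc n)))\<^sup>2 * (1 / (1 - \<rho>) + (\<Sum>k=1..n. \<rho> ^ k))) +
        (\<Sum>n<N. (norm (a (Suc n)))\<^sup>2 * \<rho> ^ Suc n))"
      unfolding sum.lessThan_Suc_shift sum.distrib[symmetric]
      by (simp add: algebra_simps)
    ultimately show ?thesis
      using 1 Gle[OF z] by (simp only: F_def \<rho>_def[symmetric]) simp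
  qed
  ultimately show ?case by blast
qed

text \<open>Littlewood subordination: |h|^2 is at most G^2 times the real part of F \<circ> \<psi>,
  whose mean over a circle about 0 is its value at 0. The factor 2 arises because both terms in the
  bound for \<open>Re F\<close> are at most \<open>1 / (1 - norm (\<psi> 0))\<close>.\<close>

lemma weighted_comp_polynomial_bound:
  assumes g: "g holomorphic_on UD" "\<And>z. z \<in> UD \<Longrightarrow> norm (g z) \<le> G"
    and psi: "\<psi> holomorphic_on UD" "\<psi> ` UD \<subseteq> UD"
  shows "(\<Sum>k<M. (norm (hcoef (\<lambda>z. g z * (\<Sum>n<N. a n * \<psi> z ^ n)) k))\<^sup>2) \<le>
    2 * G\<^sup>2 / (1 - norm (\<psi> 0)) * (\<Sum>n<N. (norm (a n))\<^sup>2)"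
proof -
  define h where "h z = g z * (\<Sum>n<N. a n * \<psi> z ^ n)" for z
  define A where "A = (\<Sum>n<N. (norm (a n))\<^sup>2)"
  obtain F where F: "F holomorphic_on UNIV"
    and Fge: "\<And>z. z \<in> UD \<Longrightarrow> (norm (\<Sum>n<N. a n * z ^ n))\<^sup>2 \<le> Re (F z)"
    and Fle: "\<And>z. z \<in> UD \<Longrightarrow> Re (F z) \<le>
      (\<Sum>n<N. (norm (a n))\<^sup>2 * (1 / (1 - norm z) + (\<Sum>k=1..n. norm z ^ k)))"
    using polynomial_square_majorant by meson
  have h: "h holomorphic_on UD"
    unfolding h_def by (intro holomorphic_intros g psi)
  have Fpsi: "(F \<circ> \<psi>) holomorphic_on UD"
    using psi F by (intro holomorphic_on_compose holomorphic_on_subset[OF F]) auto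
  have psi0: "\<psi> 0 \<in> UD" using psi(2) by (rule subsetD) simp
  have F0: "Re (F (\<psi> 0)) \<le> 2 / (1 - norm (\<psi> 0)) * A"
  proof -
    define \<rho> where "\<rho> = norm (\<psi> 0)"
    have \<rho>: "0 \<le> \<rho>" "\<rho> < 1" using psi0 by (auto simp: \<rho>_def)
    have "(\<Sum>k=1..n. \<rho> ^ k) \<le> 1 / (1 - \<rho>)" for n
    proof -
      have "(\<Sum>k=1..n. \<rho> ^ k) \<le> (\<Sum>k<Suc n. \<rho> ^ k)"
        using \<rho> by (intro sum_mono2) auto
      also have "\<dots> \<le> 1 / (1 - \<rho>)"
        using \<rho> by (simp add: sum_gp_strict divide_right_mono del: sum.lessThan_Suc)
      finally show ?thesis .
    qed
    from add_left_mono[OF this, of "1 / (1 - \<rho>)"]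
    have "1 / (1 - \<rho>) + (\<Sum>k=1..n. \<rho> ^ k) \<le> 2 / (1 - \<rho>)" for n
      by simp
    then have "(\<Sum>n<N. (norm (a n))\<^sup>2 * (1 / (1 - \<rho>) + (\<Sum>k=1..n. \<rho> ^ k))) \<le>
        (\<Sum>n<N. (norm (a n))\<^sup>2 * (2 / (1 - \<rho>)))"
      by (intro sum_mono mult_left_mono) auto
    also have "\<dots> = 2 / (1 - \<rho>) * A"
      by (simp add: A_def sum_distrib_left mult_ac)
    finally show ?thesis
      using Fle[OF psi0] by (simp add: \<rho>_def)
  qed
  have *: "(\<Sum>k<M. (norm (hcoef h k))\<^sup>2 * r ^ (2 * k)) \<le> 2 * G\<^sup>2 / (1 - norm (\<psi> 0)) * A"
    if r: "0 < r" "r < 1" for r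
  proof -
    let ?c = "circlepath 0 r"
    have cont: "continuous_on {0..1} (\<lambda>t. (norm (h (?c t)))\<^sup>2)"
    proof (intro continuous_intros)
      have "continuous_on {0..1} ?c"
        using path_circlepath[of 0 r] unfolding path_def .
      moreover have "continuous_on UD h"
        using h by (rule holomorphic_on_imp_continuous_on)
      ultimately show "continuous_on {0..1} (\<lambda>t. h (?c t))"
        using circlepath_in_UD[OF r] by (intro continuous_on_compose2[of UD h "{0..1}" ?c]) blast+
    qed
    then obtain I where I: "((\<lambda>t. (norm (h (?c t)))\<^sup>2) has_integral I) {0..1}"
      using integrable_continuous_real by blast
    have "((\<lambda>t. G\<^sup>2 * Re ((F \<circ> \<psi>) (?c t))) has_integral G\<^sup>2 * Re ((F \<circ> \<psi>) 0)) {0..1}"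
      using has_integral_linear[OF circle_mean_holomorphic[OF Fpsi r] bounded_linear_Re]
      by (intro has_integral_mult_right) (simp add: o_def)
    then have "I \<le> G\<^sup>2 * Re ((F \<circ> \<psi>) 0)"
    proof (rule has_integral_le[OF I])
      fix t
      define c where "c = ?c t"
      have c: "c \<in> UD"
        unfolding c_def by (rule circlepath_in_UD[OF r])
      then have pc: "\<psi> c \<in> UD"
        using psi(2) by blast
      have "(norm (h c))\<^sup>2 = (norm (g c))\<^sup>2 * (norm (\<Sum>n<N. a n * \<psi> c ^ n))\<^sup>2"
        by (simp add: h_def norm_mult power_mult_distrib)
      also have "\<dots> \<le> G\<^sup>2 * Re (F (\<psi> c))"
        using g(2)[OF c] Fge[OF pc] by (intro mult_mono power_mono) auto
      finally show "(norm (h (?c t)))\<^sup>2 \<le> G\<^sup>2 * Re ((F \<circ> \<psi>) (?c t))"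
        by (simp add: c_def)
    qed
    also have "\<dots> \<le> G\<^sup>2 * (2 / (1 - norm (\<psi> 0)) * A)"
      using F0 by (intro mult_left_mono) auto
    finally show ?thesis
      using circle_bessel[OF h r I, of M] by (simp add: mult_ac)
  qed
  \<comment> \<open>The circles give the bound only for r < 1; the sum is finite, so r may tend to
    1.\<close>
  have lim: "((\<lambda>r. \<Sum>k<M. (norm (hcoef h k))\<^sup>2 * r ^ (2 * k)) \<longlongrightarrow>
      (\<Sum>k<M. (norm (hcoef h k))\<^sup>2 * 1 ^ (2 * k))) (at_left (1::real))"
    by (intro tendsto_intros)
  have "eventually (\<lambda>r. r \<in> {0<..<1}) (at_left (1::real))"
    by (rule eventually_at_left_real) simp
  then have "eventually (\<lambda>r. (\<Sum>k<M. (norm (hcoef h k))\<^sup>2 * r ^ (2 * k)) \<le>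
      2 * G\<^sup>2 / (1 - norm (\<psi> 0)) * A) (at_left (1::real))"
    by (rule eventually_mono) (rule *, auto)
  from tendsto_upperbound[OF lim this]
  have "(\<Sum>k<M. (norm (hcoef h k))\<^sup>2 * 1 ^ (2 * k)) \<le> 2 * G\<^sup>2 / (1 - norm (\<psi> 0)) * A"
    by simp
  then show ?thesis by (simp add: h_def[abs_def] A_def)
qed

text \<open>Coefficients are derivatives at 0, which converge under uniform convergence near 0. The
  map \<psi> carries the closed disc of radius 1/2 into a closed disc of radius below 1, where the
  Taylor series of \<open>f\<close> converges uniformly.\<close>

lemma weighted_comp_hcoef_limit:
  assumes g: "g holomorphic_on UD" "\<And>z. z \<in> UD \<Longrightarrow> norm (g z) \<le> G"
    and psi: "\<psi> holomorphic_on UD" "\<psi> ` UD \<subseteq> UD"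
    and f: "f holomorphic_on UD"
  shows "(\<lambda>N. hcoef (\<lambda>z. g z * (\<Sum>n<N. hcoef f n * \<psi> z ^ n)) k)
           \<longlonglongrightarrow> hcoef (\<lambda>z. g z * f (\<psi> z)) k"
proof -
  let ?A = "ball 0 (1 / 2) :: complex set"
  have AU: "?A \<subseteq> UD" by auto
  have "compact (\<psi> ` cball 0 (1 / 2))"
    using psi(1) by (intro compact_continuous_image holomorphic_on_imp_continuous_on
      holomorphic_on_subset[OF psi(1)] compact_cball) auto
  moreover have "\<psi> ` cball 0 (1 / 2) \<noteq> {}" by simp
  ultimately obtain m where m: "m \<in> \<psi> ` cball 0 (1 / 2)"
    and mmax: "\<And>y. y \<in> \<psi> ` cball 0 (1 / 2) \<Longrightarrow> norm y \<le> norm m"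
    using continuous_attains_sup[of "\<psi> ` cball 0 (1 / 2)" norm]
    by (metis continuous_on_norm_id)
  have "cball 0 (1 / 2) \<subseteq> UD" by auto
  then have m1: "norm m < 1"
    using m psi(2) by fastforce
  then obtain \<rho> where \<rho>: "norm m < \<rho>" "\<rho> < 1"
    using dense by blast
  then have \<rho>0: "0 < \<rho>"
    by (meson norm_ge_zero order_le_less_trans)
  have "summable (\<lambda>n. hcoef f n * of_real \<rho> ^ n)"
    using hcoef_sums[OF f, of "of_real \<rho>"] \<rho> \<rho>0 by (auto simp: sums_iff)
  from conv_radius_geI[OF this] have "ereal \<rho> \<le> conv_radius (hcoef f)"
    using \<rho>0 by simp
  then have "ereal (norm m) < conv_radius (hcoef f)"
    using \<rho> by (meson less_ereal.simps(1) less_le_trans)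
  from powser_uniform_limit[OF this, of 0]
  have "uniform_limit (cball 0 (norm m)) (\<lambda>N w. \<Sum>n<N. hcoef f n * w ^ n)
      (\<lambda>w. \<Sum>n. hcoef f n * w ^ n) sequentially"
    by simp
  then have ul: "uniform_limit (cball 0 (norm m)) (\<lambda>N w. \<Sum>n<N. hcoef f n * w ^ n) f sequentially"
    by (rule uniform_limit_cong'[THEN iffD1, rotated -1])
       (use hcoef_sums[OF f] m1 in \<open>auto simp: sums_iff\<close>)
  have "uniform_limit ?A (\<lambda>N z. g z * (\<Sum>n<N. hcoef f n * \<psi> z ^ n)) (\<lambda>z. g z * f (\<psi> z)) sequentially"
  proof (rule uniform_limitI)
    fix e :: real assume e: "e > 0"
    \<comment> \<open>Adding 1 keeps the divisor in \<open>e / G'\<close> positive even if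
      \<open>G\<close> is 0.\<close>
    define G' where "G' = \<bar>G\<bar> + 1"
    have G': "G' > 0" by (simp add: G'_def)
    from uniform_limitD[OF ul, of "e / G'"] e G'
    have "\<forall>\<^sub>F N in sequentially. \<forall>w\<in>cball 0 (norm m). dist (\<Sum>n<N. hcoef f n * w ^ n) (f w) < e / G'"
      by simp
    then show "\<forall>\<^sub>F N in sequentially. \<forall>z\<in>?A. dist (g z * (\<Sum>n<N. hcoef f n * \<psi> z ^ n)) (g z * f (\<psi> z)) < e"
    proof (rule eventually_mono, intro ballI)
      fix N z assume N: "\<forall>w\<in>cball 0 (norm m). dist (\<Sum>n<N. hcoef f n * w ^ n) (f w) < e / G'"
        and z: "z \<in> ?A"
      have "\<psi> z \<in> cball 0 (norm m)"
        using mmax[of "\<psi> z"] z by auto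
      then have d: "dist (\<Sum>n<N. hcoef f n * \<psi> z ^ n) (f (\<psi> z)) < e / G'"
        using N by blast
      have "norm (g z) < G'"
        using g(2)[of z] AU z by (auto simp: G'_def)
      have "dist (g z * (\<Sum>n<N. hcoef f n * \<psi> z ^ n)) (g z * f (\<psi> z)) =
          norm (g z) * dist (\<Sum>n<N. hcoef f n * \<psi> z ^ n) (f (\<psi> z))"
        by (simp add: dist_norm norm_mult flip: right_diff_distrib)
      also have "\<dots> \<le> G' * dist (\<Sum>n<N. hcoef f n * \<psi> z ^ n) (f (\<psi> z))"
        using \<open>norm (g z) < G'\<close> by (intro mult_right_mono) auto
      also have "\<dots> < G' * (e / G')"
        using d G' by (intro mult_strict_left_mono) auto
      finally show "dist (g z * (\<Sum>n<N. hcoef f n * \<psi> z ^ n)) (g z * f (\<psi> z)) < e"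
        using G' by simp
    qed
  qed
  moreover have "\<forall>\<^sub>F N in sequentially. (\<lambda>z. g z * (\<Sum>n<N. hcoef f n * \<psi> z ^ n)) holomorphic_on ?A"
    by (intro always_eventually allI holomorphic_intros holomorphic_on_subset[OF g(1) AU]
        holomorphic_on_subset[OF psi(1) AU])
  ultimately have "(\<lambda>N. (deriv ^^ k) (\<lambda>z. g z * (\<Sum>n<N. hcoef f n * \<psi> z ^ n)) 0)
      \<longlonglongrightarrow> (deriv ^^ k) (\<lambda>z. g z * f (\<psi> z)) 0"
    by (rule higher_deriv_complex_uniform_limit) auto
  then show ?thesis
    unfolding hcoef_def by (intro tendsto_divide tendsto_const) auto
qed

text \<open>The polynomial bound is uniform in the number \<open>M\<close> of coefficients and in
  the truncation \<open>N\<close> of \<open>f\<close>. For fixed \<open>M\<close> it passes to the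
  limit in \<open>N\<close>; the bounded partial sums then give both membership in \<open>H2\<close>
  and the norm estimate.\<close>

theorem bounded_weighted_comp:
  assumes g: "g holomorphic_on UD" "bounded (g ` UD)"
    and psi: "\<psi> holomorphic_on UD" "\<psi> ` UD \<subseteq> UD"
  shows "bounded_H2_op (\<lambda>f z. g z * f (\<psi> z))"
proof -
  obtain G where G: "\<And>z. z \<in> UD \<Longrightarrow> norm (g z) \<le> G"
    using g(2) unfolding bounded_iff by blast
  define K where "K = 2 * G\<^sup>2 / (1 - norm (\<psi> 0))"
  have "\<psi> 0 \<in> UD" using psi(2) by (rule subsetD) simp
  then have K: "K \<ge> 0" by (simp add: K_def)
  have hol: "(\<lambda>z. g z * f (\<psi> z)) holomorphic_on UD" if "f holomorphic_on UD" for f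
    using holomorphic_on_compose_gen[OF psi(1) that psi(2)]
    by (intro holomorphic_intros g) (simp add: o_def)
  have bound: "(\<Sum>k<M. (norm (hcoef (\<lambda>z. g z * f (\<psi> z)) k))\<^sup>2) \<le> K * (\<Sum>n. (norm (hcoef f n))\<^sup>2)"
    if f: "f \<in> H2" for f M
  proof (rule LIMSEQ_le_const2)
    have fh: "f holomorphic_on UD" and fs: "summable (\<lambda>n. (norm (hcoef f n))\<^sup>2)"
      using f by (auto simp: H2_def)
    show "(\<lambda>N. \<Sum>k<M. (norm (hcoef (\<lambda>z. g z * (\<Sum>n<N. hcoef f n * \<psi> z ^ n)) k))\<^sup>2)
        \<longlonglongrightarrow> (\<Sum>k<M. (norm (hcoef (\<lambda>z. g z * f (\<psi> z)) k))\<^sup>2)"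
      by (intro tendsto_intros weighted_comp_hcoef_limit[OF g(1) G psi fh])
    have "(\<Sum>k<M. (norm (hcoef (\<lambda>z. g z * (\<Sum>n<N. hcoef f n * \<psi> z ^ n)) k))\<^sup>2)
        \<le> K * (\<Sum>n. (norm (hcoef f n))\<^sup>2)" for N
    proof -
      have "(\<Sum>n<N. (norm (hcoef f n))\<^sup>2) \<le> (\<Sum>n. (norm (hcoef f n))\<^sup>2)"
        using fs by (intro sum_le_suminf) auto
      from mult_left_mono[OF this K] show ?thesis
        using weighted_comp_polynomial_bound[OF g(1) G psi, of "hcoef f" N M]
        by (simp add: K_def)
    qed
    then show "\<exists>N0. \<forall>N\<ge>N0. (\<Sum>k<M. (norm (hcoef (\<lambda>z. g z * (\<Sum>n<N. hcoef f n * \<psi> z ^ n)) k))\<^sup>2)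
        \<le> K * (\<Sum>n. (norm (hcoef f n))\<^sup>2)"
      by blast
  qed
  have sum: "summable (\<lambda>k. (norm (hcoef (\<lambda>z. g z * f (\<psi> z)) k))\<^sup>2)" if "f \<in> H2" for f
    using bound[OF that] by (intro summableI_nonneg_bounded) auto
  have "h2_norm (\<lambda>z. g z * f (\<psi> z)) \<le> sqrt K * h2_norm f" if "f \<in> H2" for f
    using suminf_le_const[OF sum[OF that] bound[OF that]]
    by (simp add: h2_norm_def flip: real_sqrt_mult)
  then show ?thesis
    unfolding bounded_H2_op_def
    by (intro conjI exI[of _ "sqrt K"] ballI allI)
       (use sum hol in \<open>auto simp: H2_def algebra_simps\<close>)
qed

section \<open>Boundedness of the individual operators\<close>

lemma bounded_comp_op:
  assumes "\<psi> holomorphic_on UD" "\<psi> ` UD \<subseteq> UD"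
  shows "bounded_H2_op (comp_op \<psi>)"
proof -
  have "comp_op \<psi> = (\<lambda>f z. 1 * f (\<psi> z))"
    by (simp add: comp_op_def fun_eq_iff)
  then show ?thesis
    using bounded_weighted_comp[of "\<lambda>_. 1", OF _ _ assms] by (simp add: image_constant_conv)
qed

lemma bounded_mult_op:
  assumes "g holomorphic_on UD" "bounded (g ` UD)"
  shows "bounded_H2_op (mult_op g)"
  using bounded_weighted_comp[OF assms, of "\<lambda>z. z"] by (simp add: mult_op_def[abs_def])

lemma one_minus_mult_nonzero:
  fixes c z :: complex
  assumes "norm c < 1" "norm z \<le> 1"
  shows "1 - c * z \<noteq> 0"
proof
  assume "1 - c * z = 0"
  then have "norm c * norm z = 1" by (metis norm_mult norm_one right_minus_eq)
  moreover have "norm c * norm z \<le> norm c"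
    using assms by (simp add: mult_left_le)
  ultimately show False using assms by simp
qed

text \<open>A weighted composition operator whose inner map is constantly 0; the denominator of the
  weight has no zero on the closed disc, so the weight is bounded by compactness.\<close>

lemma bounded_Lambda_op:
  assumes "c \<in> UD"
  shows "bounded_H2_op (Lambda_op c)"
proof -
  define g where "g z = 1 / (1 - cnj c * z)" for z
  have nz: "1 - cnj c * z \<noteq> 0" if "norm z \<le> 1" for z
    using assms that by (intro one_minus_mult_nonzero) auto
  have hol: "g holomorphic_on cball 0 1"
    unfolding g_def by (intro holomorphic_intros nz) simp
  have "bounded (g ` cball 0 1)"
    by (intro compact_imp_bounded compact_continuous_image
        holomorphic_on_imp_continuous_on[OF hol] compact_cball)
  then have "bounded_H2_op (\<lambda>f z. g z * f ((\<lambda>_. 0) z))"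
    by (intro bounded_weighted_comp holomorphic_on_subset[OF hol])
       (auto elim: bounded_subset)
  then show ?thesis
    by (simp add: Lambda_op_def[abs_def] g_def)
qed

lemma bshift_sums:
  assumes f: "f holomorphic_on UD" and z: "z \<in> UD"
  shows "(\<lambda>n. hcoef f (Suc n) * z ^ n) sums bshift f z"
proof (cases "z = 0")
  case True
  then show ?thesis
    using powser_sums_zero[of "\<lambda>n. hcoef f (Suc n)"] by (simp add: bshift_def hcoef_def)
next
  case False
  have "(\<lambda>n. hcoef f (Suc n) * z ^ Suc n) sums (f z - f 0)"
    using hcoef_sums[OF f z] by (subst sums_Suc_iff) (simp add: hcoef_def)
  from sums_divide[OF this, of z] False show ?thesis
    by (simp add: bshift_def)
qed

lemma hcoef_bshift:
  "f holomorphic_on UD \<Longrightarrow> hcoef (bshift f) n = hcoef f (Suc n)"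
  by (intro hcoef_unique bshift_sums)

text \<open>On Taylor coefficients the operator drops index 0 and shifts the rest, which cannot
  increase the norm.\<close>

lemma bounded_bshift: "bounded_H2_op bshift"
proof -
  have hol: "bshift f holomorphic_on UD" if "f holomorphic_on UD" for f
    using bshift_sums[OF that] by (intro power_series_holomorphic[of 0 1 "\<lambda>n. hcoef f (Suc n)"]) auto
  have "bshift f \<in> H2 \<and> h2_norm (bshift f) \<le> h2_norm f" if f: "f \<in> H2" for f
  proof -
    have fh: "f holomorphic_on UD" and fs: "summable (\<lambda>n. (norm (hcoef f n))\<^sup>2)"
      using f by (auto simp: H2_def)
    have "(\<Sum>n. (norm (hcoef f (Suc n)))\<^sup>2) \<le> (\<Sum>n. (norm (hcoef f n))\<^sup>2)"
      using suminf_split_head[OF fs] by simp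
    moreover have "summable (\<lambda>n. (norm (hcoef f (Suc n)))\<^sup>2)"
      using fs by (subst summable_Suc_iff)
    ultimately show ?thesis
      by (simp add: H2_def h2_norm_def hcoef_bshift hol fh)
  qed
  moreover have "bshift (\<lambda>w. a * f w + b * g w) z = a * bshift f z + b * bshift g z"
    if "f \<in> H2" "g \<in> H2" for f g a b z
  proof -
    \<comment> \<open>The value of the shift at 0 is the coefficient of index 1, so linearity of
      \<open>hcoef\<close> covers this case.\<close>
    have "deriv (\<lambda>w. a * f w + b * g w) 0 = a * deriv f 0 + b * deriv g 0"
      using that hcoef_lincomb[of f g a b 1] by (simp add: H2_def hcoef_def)
    then show ?thesis
      by (simp add: bshift_def diff_divide_distrib add_divide_distrib algebra_simps)
  qed
  ultimately show ?thesis
    unfolding bounded_H2_op_def by (metis mult_1)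
qed

subsection \<open>The inner product and adjoints\<close>

text \<open>The Cauchy-Schwarz inequality for partial sums, uniform in \<open>N\<close>, gives
  absolute convergence and the norm bound together.\<close>

lemma H2_inner_summable_bound:
  assumes f: "f \<in> H2" and g: "g \<in> H2"
  shows "summable (\<lambda>n. hcoef f n * cnj (hcoef g n))"
    and "norm (h2_inner f g) \<le> h2_norm f * h2_norm g"
proof -
  have fs: "summable (\<lambda>n. (norm (hcoef f n))\<^sup>2)" and gs: "summable (\<lambda>n. (norm (hcoef g n))\<^sup>2)"
    using f g by (auto simp: H2_def)
  have part: "(\<Sum>n<N. norm (hcoef f n * cnj (hcoef g n))) \<le> h2_norm f * h2_norm g" for N
  proof -
    have "(\<Sum>n<N. norm (hcoef f n * cnj (hcoef g n))) \<le>
        L2_set (\<lambda>n. norm (hcoef f n)) {..<N} * L2_set (\<lambda>n. norm (hcoef g n)) {..<N}"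
      using L2_set_mult_ineq[of "\<lambda>n. norm (hcoef f n)" "\<lambda>n. norm (hcoef g n)"]
      by (simp add: norm_mult)
    also have "\<dots> \<le> h2_norm f * h2_norm g"
      unfolding L2_set_def h2_norm_def
      by (intro mult_mono real_sqrt_le_mono sum_le_suminf fs gs real_sqrt_ge_zero suminf_nonneg sum_nonneg) auto
    finally show ?thesis .
  qed
  have ns: "summable (\<lambda>n. norm (hcoef f n * cnj (hcoef g n)))"
    using part by (intro summableI_nonneg_bounded) auto
  then show "summable (\<lambda>n. hcoef f n * cnj (hcoef g n))"
    by (rule summable_norm_cancel)
  show "norm (h2_inner f g) \<le> h2_norm f * h2_norm g"
    unfolding h2_inner_def using summable_norm[OF ns] suminf_le_const[OF ns part] by linarith
qed

lemma H2_lincomb: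
  assumes f: "f \<in> H2" and g: "g \<in> H2"
  shows "(\<lambda>z. a * f z + b * g z) \<in> H2"
proof -
  have fh: "f holomorphic_on UD" "g holomorphic_on UD"
    using assms by (auto simp: H2_def)
  have "summable (\<lambda>n. 2 * ((norm a)\<^sup>2 * (norm (hcoef f n))\<^sup>2 + (norm b)\<^sup>2 * (norm (hcoef g n))\<^sup>2))"
    using assms by (intro summable_mult summable_add) (auto simp: H2_def)
  then have "summable (\<lambda>n. (norm (a * hcoef f n + b * hcoef g n))\<^sup>2)"
  proof (rule summable_comparison_test'[where N = 0])
    fix n
    define u v where "u = norm (a * hcoef f n)" and "v = norm (b * hcoef g n)"
    have "(norm (a * hcoef f n + b * hcoef g n))\<^sup>2 \<le> (u + v)\<^sup>2"
      unfolding u_def v_def by (intro power_mono norm_triangle_ineq) auto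
    also have "\<dots> \<le> 2 * (u\<^sup>2 + v\<^sup>2)"
      using sum_squares_bound[of u v] by (simp add: power2_sum)
    finally show "norm ((norm (a * hcoef f n + b * hcoef g n))\<^sup>2) \<le>
        2 * ((norm a)\<^sup>2 * (norm (hcoef f n))\<^sup>2 + (norm b)\<^sup>2 * (norm (hcoef g n))\<^sup>2)"
      by (simp add: u_def v_def norm_mult power_mult_distrib)
  qed
  then show ?thesis
    using fh by (auto simp: H2_def hcoef_lincomb intro!: holomorphic_intros)
qed

lemma h2_inner_lincomb_right:
  assumes "g \<in> H2" "f1 \<in> H2" "f2 \<in> H2"
  shows "h2_inner g (\<lambda>z. a * f1 z + b * f2 z) = cnj a * h2_inner g f1 + cnj b * h2_inner g f2"
proof -
  have "(\<lambda>n. cnj a * (hcoef g n * cnj (hcoef f1 n)) + cnj b * (hcoef g n * cnj (hcoef f2 n))) sums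
      (cnj a * h2_inner g f1 + cnj b * h2_inner g f2)"
    unfolding h2_inner_def
    by (intro sums_add sums_mult summable_sums H2_inner_summable_bound assms)
  moreover have "hcoef (\<lambda>z. a * f1 z + b * f2 z) n = a * hcoef f1 n + b * hcoef f2 n" for n
    using assms by (intro hcoef_lincomb) (auto simp: H2_def)
  ultimately show ?thesis
    by (simp add: h2_inner_def[of g "\<lambda>z. a * f1 z + b * f2 z"] sums_iff algebra_simps)
qed

lemma h2_inner_commute:
  assumes "f \<in> H2" "g \<in> H2"
  shows "h2_inner f g = cnj (h2_inner g f)"
proof -
  have "(\<lambda>n. hcoef g n * cnj (hcoef f n)) sums h2_inner g f"
    unfolding h2_inner_def by (intro summable_sums H2_inner_summable_bound assms)
  then have "(\<lambda>n. cnj (hcoef g n * cnj (hcoef f n))) sums cnj (h2_inner g f)"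
    by (simp only: sums_cnj)
  then show ?thesis
    by (simp add: sums_iff h2_inner_def mult.commute)
qed

lemma H2_polynomial: "(\<lambda>z. \<Sum>n<N. a n * z ^ n) \<in> H2"
  unfolding H2_def
  by (auto intro!: holomorphic_intros summable_finite[of "{..<N}"] simp: hcoef_polynomial split: if_splits)

lemma H2_monomial: "(\<lambda>z. z ^ n) \<in> H2"
  unfolding H2_def
  by (auto intro!: holomorphic_intros summable_finite[of "{n}"] simp: hcoef_monomial split: if_splits)

text \<open>The Taylor sections of \<open>f\<close> converge to \<open>f\<close> in the
  \<open>H2\<close> norm, and a bounded operator followed by pairing with \<open>g\<close> respects
  this limit. The coefficients appear conjugated because the inner product is antilinear in its
  second argument.\<close>

lemma h2_inner_bounded_op_sums:
  assumes T: "bounded_H2_op T" and f: "f \<in> H2" and g: "g \<in> H2"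
  shows "(\<lambda>n. cnj (hcoef f n) * h2_inner g (T (\<lambda>z. z ^ n))) sums h2_inner g (T f)"
proof -
  obtain C where C: "\<And>f. f \<in> H2 \<Longrightarrow> h2_norm (T f) \<le> C * h2_norm f"
    using T unfolding bounded_H2_op_def by blast
  have TH: "T u \<in> H2" if "u \<in> H2" for u
    using T that unfolding bounded_H2_op_def by blast
  have lin: "h2_inner g (T (\<lambda>z. a * u z + b * v z)) = cnj a * h2_inner g (T u) + cnj b * h2_inner g (T v)"
    if "u \<in> H2" "v \<in> H2" for u v a b
  proof -
    \<comment> \<open>Linearity in \<open>bounded_H2_op\<close> is pointwise on the disc only, so
      the comparison goes through coefficients and not through equality of functions.\<close>
    have "hcoef (T (\<lambda>z. a * u z + b * v z)) n = hcoef (\<lambda>z. a * T u z + b * T v z) n" for n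
      using T that unfolding bounded_H2_op_def by (intro hcoef_cong) blast
    then have "h2_inner g (T (\<lambda>z. a * u z + b * v z)) = h2_inner g (\<lambda>z. a * T u z + b * T v z)"
      by (simp add: h2_inner_def)
    then show ?thesis
      using that by (simp add: h2_inner_lincomb_right TH g)
  qed
  define s where "s N z = (\<Sum>n<N. hcoef f n * z ^ n)" for N z
  have sH: "s N \<in> H2" for N
    using H2_polynomial[of "hcoef f" N] by (simp add: s_def[abs_def])
  have part: "h2_inner g (T (s N)) = (\<Sum>n<N. cnj (hcoef f n) * h2_inner g (T (\<lambda>z. z ^ n)))" for N
  proof (induction N)
    case 0
    \<comment> \<open>Writing the zero function as a combination with zero coefficients lets
      \<open>lin\<close> evaluate the pairing as 0.\<close>
    have "s 0 = (\<lambda>z. 0 * s 0 z + 0 * s 0 z)" by (simp add: s_def fun_eq_iff)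
    then show ?case
      using lin[OF sH sH, of 0 0 0 0] by simp
  next
    case (Suc N)
    have "s (Suc N) = (\<lambda>z. 1 * s N z + hcoef f N * z ^ N)" by (simp add: s_def fun_eq_iff)
    then have "h2_inner g (T (s (Suc N))) = h2_inner g (T (s N)) + cnj (hcoef f N) * h2_inner g (T (\<lambda>z. z ^ N))"
      using lin[OF sH[of N] H2_monomial[of N], of 1 "hcoef f N"] by simp
    then show ?case by (simp add: Suc.IH)
  qed
  \<comment> \<open>The Taylor tail, written in the shape that \<open>H2_lincomb\<close> and
    \<open>lin\<close> expect.\<close>
  define e where "e N z = 1 * f z + (-1) * s N z" for N z
  have eH: "e N \<in> H2" for N
    unfolding e_def[abs_def] by (intro H2_lincomb f sH)
  have fh: "f holomorphic_on UD" and fs: "summable (\<lambda>n. (norm (hcoef f n))\<^sup>2)"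
    using f by (auto simp: H2_def)
  have enorm: "h2_norm (e N) = sqrt ((\<Sum>n. (norm (hcoef f n))\<^sup>2) - (\<Sum>n<N. (norm (hcoef f n))\<^sup>2))" for N
  proof -
    have "hcoef (e N) n = (if n < N then 0 else hcoef f n)" for n
      using fh sH[of N] unfolding e_def[abs_def]
      by (subst hcoef_lincomb) (auto simp: H2_def s_def[abs_def] hcoef_polynomial)
    then have "(\<lambda>n. (norm (hcoef (e N) n))\<^sup>2) = (\<lambda>n. (norm (hcoef f n))\<^sup>2 - (if n \<in> {..<N} then (norm (hcoef f n))\<^sup>2 else 0))"
      by (auto simp: fun_eq_iff)
    moreover have "\<dots> sums ((\<Sum>n. (norm (hcoef f n))\<^sup>2) - (\<Sum>n<N. (norm (hcoef f n))\<^sup>2))"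
      by (intro sums_diff summable_sums fs sums_If_finite_set) auto
    ultimately show ?thesis
      by (simp add: h2_norm_def sums_iff)
  qed
  have "(\<lambda>N. (\<Sum>n. (norm (hcoef f n))\<^sup>2) - (\<Sum>n<N. (norm (hcoef f n))\<^sup>2)) \<longlonglongrightarrow>
      (\<Sum>n. (norm (hcoef f n))\<^sup>2) - (\<Sum>n. (norm (hcoef f n))\<^sup>2)"
    by (intro tendsto_intros summable_LIMSEQ fs)
  from tendsto_mult_left[OF tendsto_mult_left[OF tendsto_real_sqrt[OF this]]]
  have "(\<lambda>N. h2_norm g * (C * h2_norm (e N))) \<longlonglongrightarrow>
      h2_norm g * (C * sqrt ((\<Sum>n. (norm (hcoef f n))\<^sup>2) - (\<Sum>n. (norm (hcoef f n))\<^sup>2)))"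
    unfolding enorm .
  then have lim: "(\<lambda>N. h2_norm g * (C * h2_norm (e N))) \<longlonglongrightarrow> 0"
    by simp
  have gn: "0 \<le> h2_norm g"
    using g by (auto simp: h2_norm_def H2_def intro!: suminf_nonneg)
  have "(\<lambda>N. h2_inner g (T f) - h2_inner g (T (s N))) \<longlonglongrightarrow> 0"
  proof (rule Lim_null_comparison[OF always_eventually lim], rule allI)
    fix N
    have "h2_inner g (T f) - h2_inner g (T (s N)) = h2_inner g (T (e N))"
      unfolding e_def[abs_def] using lin[OF f sH, of 1 "-1"] by simp
    also have "norm \<dots> \<le> h2_norm g * h2_norm (T (e N))"
      by (intro H2_inner_summable_bound g TH eH)
    also have "\<dots> \<le> h2_norm g * (C * h2_norm (e N))"
      using gn by (intro mult_left_mono C eH)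
    finally show "norm (h2_inner g (T f) - h2_inner g (T (s N))) \<le> h2_norm g * (C * h2_norm (e N))" .
  qed
  then have "(\<lambda>N. h2_inner g (T (s N))) \<longlonglongrightarrow> h2_inner g (T f)"
    using tendsto_diff[OF tendsto_const[of "h2_inner g (T f)"]] by fastforce
  then show ?thesis
    unfolding sums_def part .
qed

text \<open>An adjoint is determined by its action on the reproducing kernels
  \<open>1 / (1 - cnj w * z)\<close>, whose Taylor coefficients are the powers of \<open>cnj w\<close>.\<close>

lemma is_H2_adjoint_kernelI:
  assumes T: "bounded_H2_op T"
    and S: "\<And>g w. g \<in> H2 \<Longrightarrow> w \<in> UD \<Longrightarrow> h2_inner g (T (\<lambda>z. 1 / (1 - cnj w * z))) = S g w"
  shows "is_H2_adjoint S T"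
  unfolding is_H2_adjoint_def
proof (intro ballI)
  fix f g assume f: "f \<in> H2" and g: "g \<in> H2"
  have TfH: "T f \<in> H2"
    using T f unfolding bounded_H2_op_def by blast
  define c where "c n = h2_inner g (T (\<lambda>z. z ^ n))" for n
  have "hcoef (S g) n = c n" for n
  proof (rule hcoef_unique)
    fix w :: complex assume w: "w \<in> UD"
    define k where "k z = 1 / (1 - cnj w * z)" for z
    have cw: "cnj w \<in> UD" using w by simp
    have kc: "hcoef k n = cnj w ^ n" for n
      unfolding k_def[abs_def] using cw by (rule hcoef_geometric)
    have "k holomorphic_on UD"
      unfolding k_def using w by (intro holomorphic_intros one_minus_mult_nonzero) auto
    moreover have "summable (\<lambda>n. (norm (cnj w ^ n))\<^sup>2)"
    proof -
      have "(norm w)\<^sup>2 < 1" using w by (simp add: power_less_one_iff)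
      moreover have "(norm (cnj w ^ n))\<^sup>2 = ((norm w)\<^sup>2) ^ n" for n
        unfolding norm_power complex_mod_cnj by (metis power_mult mult.commute)
      ultimately show ?thesis
        by (simp add: summable_geometric)
    qed
    ultimately have "k \<in> H2" by (simp add: H2_def kc)
    \<comment> \<open>Conjugation turns the kernel coefficients \<open>cnj w ^ n\<close> into
      \<open>w ^ n\<close>, so \<open>S g\<close> is the power series with coefficients
      \<open>c n\<close>.\<close>
    from h2_inner_bounded_op_sums[OF T this g]
    show "(\<lambda>n. c n * w ^ n) sums S g w"
      unfolding kc using S[OF g w] by (simp add: c_def k_def[abs_def] mult.commute)
  qed
  moreover have "(\<lambda>n. cnj (cnj (hcoef f n) * c n)) sums cnj (h2_inner g (T f))"
    unfolding sums_cnj c_def by (rule h2_inner_bounded_op_sums[OF T f g])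
  ultimately have "h2_inner f (S g) = cnj (h2_inner g (T f))"
    by (simp add: h2_inner_def sums_iff)
  then show "h2_inner (T f) g = h2_inner f (S g)"
    using h2_inner_commute[OF TfH g] by simp
qed

subsection \<open>Polynomials with distinct roots\<close>

text \<open>Two polynomials of degree at most n that share the coefficient of index n and agree at n
  points are equal.\<close>

lemma poly_factor_distinct_roots:
  fixes A :: "'a :: field poly"
  assumes "finite Z" "\<And>s. s \<in> Z \<Longrightarrow> poly A s = 0" "card Z = degree A"
  shows "A = smult (lead_coeff A) (\<Prod>s\<in>Z. [:- s, 1:])"
proof (rule poly_eqI_degree_lead_coeff[of _ "degree A" _ Z])
  have deg: "degree (\<Prod>s\<in>Z. [:- s, 1:]) = degree A"
    using assms by (subst degree_prod_sum_eq) auto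
  then have "coeff (\<Prod>s\<in>Z. [:- s, 1:]) (degree A) = 1"
    using lead_coeff_prod[of "\<lambda>s. [:- s, 1:]" Z] by simp
  then show "coeff A (degree A) = coeff (smult (lead_coeff A) (\<Prod>s\<in>Z. [:- s, 1:])) (degree A)"
    by simp
  show "degree (smult (lead_coeff A) (\<Prod>s\<in>Z. [:- s, 1:])) \<le> degree A"
    using degree_smult_le[of "lead_coeff A" "\<Prod>s\<in>Z. [:- s, 1:]"] deg by simp
  show "poly A z = poly (smult (lead_coeff A) (\<Prod>s\<in>Z. [:- s, 1:])) z" if "z \<in> Z" for z
    using assms that by (auto simp: poly_prod)
qed (use assms in auto)

lemma pderiv_distinct_roots:
  fixes A :: "'a :: field poly"
  assumes "finite Z" "\<And>s. s \<in> Z \<Longrightarrow> poly A s = 0" "card Z = degree A" "s \<in> Z"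
  shows "poly (pderiv A) s = lead_coeff A * (\<Prod>t\<in>Z - {s}. s - t)"
proof -
  have "pderiv A = smult (lead_coeff A) (\<Sum>t\<in>Z. \<Prod>u\<in>Z - {t}. [:- u, 1:])"
    by (subst poly_factor_distinct_roots[OF assms(1-3)])
       (simp_all add: pderiv_smult pderiv_prod pderiv_pCons)
  \<comment> \<open>Every product with t different from s contains the factor s - s.\<close>
  moreover have "(\<Sum>t\<in>Z. \<Prod>u\<in>Z - {t}. s - u) = (\<Sum>t\<in>{s}. \<Prod>u\<in>Z - {t}. s - u)"
    using assms by (intro sum.mono_neutral_right) (auto intro!: prod_zero)
  ultimately show ?thesis
    by (simp add: poly_sum poly_prod)
qed

text \<open>Lagrange interpolation at the roots of \<open>A\<close>, divided by \<open>A\<close>. As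
  \<open>P\<close> may have the same degree as \<open>A\<close>, a constant term appears.\<close>

lemma partial_fractions_distinct_roots:
  fixes A P :: "'a :: field poly"
  assumes Z: "finite Z" "\<And>s. s \<in> Z \<Longrightarrow> poly A s = 0" "card Z = degree A" and A: "A \<noteq> 0"
    and P: "degree P \<le> degree A" and y: "poly A y \<noteq> 0"
  shows "poly P y / poly A y = coeff P (degree A) / lead_coeff A +
    (\<Sum>s\<in>Z. poly P s / poly (pderiv A) s / (y - s))"
proof -
  define n where "n = degree A"
  define L where "L s = (\<Prod>t\<in>Z - {s}. [:- t, 1:])" for s
  define l where "l = lead_coeff A"
  have l: "l \<noteq> 0" using A by (simp add: l_def)
  have fact: "A = smult l (\<Prod>s\<in>Z. [:- s, 1:])"
    unfolding l_def by (rule poly_factor_distinct_roots[OF Z])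
  have pd: "poly (pderiv A) s = l * poly (L s) s" if "s \<in> Z" for s
    unfolding l_def by (simp add: pderiv_distinct_roots[OF Z that] L_def poly_prod)
  have Ls: "poly (L s) s \<noteq> 0" if "s \<in> Z" for s
    using Z(1) by (auto simp: L_def poly_prod)
  have Lt: "poly (L s) t = 0" if "s \<in> Z" "t \<in> Z" "s \<noteq> t" for s t
    using that Z(1) by (auto simp: L_def poly_prod)
  have degL: "degree (L s) < n" if "s \<in> Z" for s
  proof -
    have "degree (L s) = card (Z - {s})"
      unfolding L_def by (subst degree_prod_sum_eq) auto
    also have "\<dots> < card Z" using Z(1) that by (rule card_Diff1_less)
    finally show ?thesis using Z(3) by (simp add: n_def)
  qed
  \<comment> \<open>The Lagrange interpolant has degree below \<open>n\<close>; the multiple of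
    \<open>A\<close> supplies the coefficient of index \<open>n\<close> without changing the values
    at the roots.\<close>
  define Q where "Q = smult (coeff P n / l) A + (\<Sum>s\<in>Z. smult (poly P s / poly (L s) s) (L s))"
  have "P = Q"
  proof (rule poly_eqI_degree_lead_coeff[of _ n _ Z])
    have "coeff (\<Sum>s\<in>Z. smult (poly P s / poly (L s) s) (L s)) n = 0"
      unfolding coeff_sum by (rule sum.neutral) (simp add: coeff_eq_0 degL)
    then show "coeff P n = coeff Q n"
      using l by (simp add: Q_def l_def n_def)
    have "degree (\<Sum>s\<in>Z. smult (poly P s / poly (L s) s) (L s)) \<le> n"
      using degL by (intro degree_sum_le Z(1)) (meson degree_smult_le le_trans less_imp_le)
    moreover have "degree (smult (coeff P n / l) A) \<le> n"
      by (simp add: n_def)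
    ultimately show "degree Q \<le> n"
      unfolding Q_def by (intro degree_add_le)
    show "poly P z = poly Q z" if z: "z \<in> Z" for z
    proof -
      have "(\<Sum>s\<in>Z. poly P s / poly (L s) s * poly (L s) z) =
          (\<Sum>s\<in>{z}. poly P s / poly (L s) s * poly (L s) z)"
        using z Z(1) Lt by (intro sum.mono_neutral_right) auto
      then show ?thesis
        using z Z(2)[OF z] Ls[OF z] by (simp add: Q_def poly_sum)
    qed
  qed (use Z P in \<open>auto simp: n_def\<close>)
  have "poly (L s) y / poly A y = 1 / (l * (y - s))" if s: "s \<in> Z" for s
  proof -
    have "poly A y = l * ((y - s) * poly (L s) y)"
      unfolding L_def by (subst fact) (simp add: poly_prod prod.remove[OF Z(1) s] algebra_simps)
    moreover from this y have "poly (L s) y \<noteq> 0" by auto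
    ultimately show ?thesis by simp
  qed
  then have "poly P s / poly (L s) s * poly (L s) y / poly A y =
      poly P s / poly (L s) s * (1 / (l * (y - s)))" if "s \<in> Z" for s
    using that by (metis times_divide_eq_right)
  then have "(\<Sum>s\<in>Z. poly P s / poly (L s) s * poly (L s) y) / poly A y =
      (\<Sum>s\<in>Z. poly P s / poly (L s) s * (1 / (l * (y - s))))"
    unfolding sum_divide_distrib by (intro sum.cong refl)
  moreover have "poly P y / poly A y = coeff P n / l +
      (\<Sum>s\<in>Z. poly P s / poly (L s) s * poly (L s) y) / poly A y"
    using y by (subst \<open>P = Q\<close>) (simp add: Q_def poly_sum add_divide_distrib)
  ultimately have "poly P y / poly A y = coeff P n / l +
      (\<Sum>s\<in>Z. poly P s / poly (L s) s * (1 / (l * (y - s))))"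
    by simp
  then show ?thesis
    by (simp add: n_def l_def[symmetric] pd mult_ac)
qed

subsection \<open>Coverings with fibres of constant finite cardinality\<close>

text \<open>Disjoint discs around the d points of a fibre, on which F is injective, have open
  images. Over the intersection of these images each disc contributes one point to every fibre, so
  constant cardinality leaves no point of the fibre outside the discs.\<close>

lemma covering_space_holomorphic_const_fibre:
  assumes E: "open E" and F: "F holomorphic_on E" and dF: "\<And>s. s \<in> E \<Longrightarrow> deriv F s \<noteq> 0"
    and S: "open S" and im: "F ` E = S"
    and card: "\<And>w. w \<in> S \<Longrightarrow> card {s \<in> E. F s = w} = d" and d: "d > 0"
  shows "covering_space E F S"
proof
  show "continuous_on E F" using F by (rule holomorphic_on_imp_continuous_on)
  show "F ` E = S" by (rule im)
  fix w assume w: "w \<in> S"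
  define Z where "Z = {s \<in> E. F s = w}"
  \<comment> \<open>An infinite set has \<open>card\<close> 0, so positivity of \<open>d\<close>
    makes the fibre finite.\<close>
  have fin: "finite Z" using card[OF w] d unfolding Z_def by (metis card.infinite less_irrefl)
  have "\<exists>r>0. ball s r \<subseteq> E \<and> inj_on F (ball s r)" if "s \<in> Z" for s
    using has_complex_derivative_locally_injective[OF F _ E dF, of s] that unfolding Z_def by blast
  then obtain r where r: "\<And>s. s \<in> Z \<Longrightarrow> r s > 0 \<and> ball s (r s) \<subseteq> E \<and> inj_on F (ball s (r s))"
    by metis
  obtain \<delta> where \<delta>: "\<And>s. \<delta> s > 0" "\<And>s t. t \<in> Z \<Longrightarrow> t \<noteq> s \<Longrightarrow> \<delta> s \<le> dist s t"
    using finite_set_avoid[OF fin] by metis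
  \<comment> \<open>Half of the separation \<open>\<delta> s\<close> makes the discs pairwise
    disjoint.\<close>
  define B where "B s = ball s (min (r s) (\<delta> s / 2))" for s
  have Bs: "s \<in> B s" "open (B s)" "B s \<subseteq> E" "inj_on F (B s)" if "s \<in> Z" for s
    using r[OF that] \<delta>(1)[of s] by (auto simp: B_def intro: inj_on_subset)
  have Bdisj: "s = t" if "s \<in> Z" "t \<in> Z" "x \<in> B s" "x \<in> B t" for s t x
  proof (rule ccontr)
    assume "s \<noteq> t"
    then have "\<delta> s \<le> dist s t" "\<delta> t \<le> dist s t"
      using \<delta>(2)[of t s] \<delta>(2)[of s t] that by (auto simp: dist_commute)
    moreover have "dist s x < \<delta> s / 2" "dist t x < \<delta> t / 2"
      using that by (auto simp: B_def)
    ultimately show False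
      using dist_triangle2[of s t x] by linarith
  qed
  have FB: "F holomorphic_on B s" if "s \<in> Z" for s
    using F Bs(3)[OF that] by (rule holomorphic_on_subset)
  define T where "T = S \<inter> (\<Inter>s\<in>Z. F ` B s)"
  have T: "open T" "T \<subseteq> S"
    unfolding T_def using S fin Bs FB by (auto intro!: open_Int open_INT open_mapping_thm3)
  have wT: "w \<in> T"
    using w Bs(1) by (auto simp: T_def Z_def)
  define u where "u s = B s \<inter> F -` T" for s
  have u: "open (u s)" "u s \<subseteq> E" if "s \<in> Z" for s
    unfolding u_def using Bs[OF that] FB[OF that] T(1)
    by (auto intro!: continuous_open_preimage holomorphic_on_imp_continuous_on)
  have cover: "\<exists>s\<in>Z. x \<in> B s" if x: "x \<in> E" "F x \<in> T" for x
  proof -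
    have "\<exists>t. t \<in> B s \<and> F t = F x" if "s \<in> Z" for s
      using x that by (force simp: T_def)
    then obtain t where t: "\<And>s. s \<in> Z \<Longrightarrow> t s \<in> B s \<and> F (t s) = F x"
      by metis
    have "inj_on t Z"
      using t Bdisj by (metis inj_onI)
    moreover have "t ` Z \<subseteq> {s \<in> E. F s = F x}"
      using t Bs(3) by blast
    moreover have cx: "card {s \<in> E. F s = F x} = d" "card Z = d"
      using card[of "F x"] card[OF w] T x unfolding Z_def by auto
    moreover have "finite {s \<in> E. F s = F x}"
      using cx d by (intro card_ge_0_finite) simp
    ultimately have "t ` Z = {s \<in> E. F s = F x}"
      by (metis card_image card_subset_eq)
    then have "x \<in> t ` Z" using x by simp
    then show ?thesis using t by blast
  qed
  have "\<Union>(u ` Z) = E \<inter> F -` T"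
    using cover u(2) by (auto simp: u_def)
  moreover have "\<forall>v\<in>u ` Z. openin (top_of_set E) v"
    using u by (auto simp: open_openin_trans E)
  moreover have "pairwise disjnt (u ` Z)"
    unfolding pairwise_def disjnt_def u_def using Bdisj by blast
  moreover have "\<forall>v\<in>u ` Z. \<exists>g. homeomorphism v T F g"
  proof
    fix v assume "v \<in> u ` Z"
    then obtain s where s: "s \<in> Z" and v: "v = u s" by blast
    obtain g where g: "g holomorphic_on F ` B s" and gF: "\<And>z. z \<in> B s \<Longrightarrow> g (F z) = z"
      using holomorphic_has_inverse[OF FB[OF s] Bs(2,4)[OF s]] by metis
    have TB: "T \<subseteq> F ` B s" using s by (auto simp: T_def)
    have "homeomorphism v T F g"
    proof (rule homeomorphismI)
      show "continuous_on v F"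
        using FB[OF s] unfolding v u_def
        by (intro holomorphic_on_imp_continuous_on) (auto elim: holomorphic_on_subset)
      show "continuous_on T g"
        using holomorphic_on_subset[OF g TB] by (rule holomorphic_on_imp_continuous_on)
      show "F ` v \<subseteq> T" by (auto simp: v u_def)
      show "g ` T \<subseteq> v"
      proof
        fix y assume "y \<in> g ` T"
        then obtain x where x: "x \<in> T" "y = g x" by blast
        then obtain z where "z \<in> B s" "x = F z" using TB by blast
        then show "y \<in> v" using x gF by (auto simp: v u_def)
      qed
      show "g (F x) = x" if "x \<in> v" for x
        using that gF by (auto simp: v u_def)
      show "F (g y) = y" if "y \<in> T" for y
        using that gF TB by force
    qed
    then show "\<exists>g. homeomorphism v T F g" by (rule exI[of _ g])
  qed
  ultimately show "\<exists>T. w \<in> T \<and> openin (top_of_set S) T \<and>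
      (\<exists>v. \<Union>v = E \<inter> F -` T \<and> (\<forall>u\<in>v. openin (top_of_set E) u) \<and>
        pairwise disjnt v \<and> (\<forall>u\<in>v. \<exists>q. homeomorphism u T F q))"
    using wT T S by (intro exI[of _ T] conjI exI[of _ "u ` Z"]) (auto simp: open_openin_trans)
qed

subsection \<open>The exterior map\<close>

text \<open>Conjugate-reversed polynomials: the exterior map of \<open>p / q\<close> is
  \<open>conj_reflect d q / conj_reflect d p\<close>, where \<open>d\<close> is the degree of the map.\<close>

definition conj_reflect :: "nat \<Rightarrow> complex poly \<Rightarrow> complex poly" where
  "conj_reflect d r = (\<Sum>i\<le>d. monom (cnj (coeff r (d - i))) i)"

lemma coeff_conj_reflect:
  "coeff (conj_reflect d r) i = (if i \<le> d then cnj (coeff r (d - i)) else 0)"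
  by (simp add: conj_reflect_def coeff_sum coeff_monom if_distrib cong: if_cong)

lemma degree_conj_reflect: "degree (conj_reflect d r) \<le> d"
  by (rule degree_le) (simp add: coeff_conj_reflect)

lemma poly_conj_reflect_0: "poly (conj_reflect d r) 0 = cnj (coeff r d)"
  by (simp add: poly_0_coeff_0 coeff_conj_reflect)

lemma poly_conj_reflect:
  assumes "degree r \<le> d" "s \<noteq> 0"
  shows "poly (conj_reflect d r) s = s ^ d * cnj (poly r (1 / cnj s))"
proof -
  have "poly (conj_reflect d r) s = (\<Sum>i\<le>d. cnj (coeff r (d - i)) * s ^ i)"
    by (simp add: conj_reflect_def poly_sum poly_monom)
  also have "\<dots> = (\<Sum>i\<le>d. cnj (coeff r i) * s ^ (d - i))"
    by (rule sum.reindex_bij_witness[of _ "\<lambda>i. d - i" "\<lambda>i. d - i"]) auto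
  also have "\<dots> = (\<Sum>i\<le>d. s ^ d * (cnj (coeff r i) * (1 / s) ^ i))"
    using assms(2) by (intro sum.cong refl) (simp add: power_diff power_one_over field_simps)
  also have "\<dots> = s ^ d * cnj (\<Sum>i\<le>d. coeff r i * (1 / cnj s) ^ i)"
    by (simp add: sum_distrib_left)
  also have "(\<Sum>i\<le>d. coeff r i * (1 / cnj s) ^ i) = poly r (1 / cnj s)"
    unfolding poly_altdef using assms(1)
    by (intro sum.mono_neutral_right) (auto simp: coeff_eq_0)
  finally show ?thesis .
qed

locale outer_regular_map =
  fixes p q :: "complex poly" and d :: nat
  assumes rat: "in_Rat_U p q" and deg: "d = rat_degree p q" and reg: "outer_regular p q"
begin

definition P where "P = conj_reflect d q"
definition R where "R = conj_reflect d p"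

text \<open>The roots of \<open>A w\<close> are the preimages of \<open>w\<close> under the exterior map.\<close>

definition A where "A w = P - smult w R"

lemma poly_A: "poly (A w) s = poly P s - w * poly R s"
  by (simp add: A_def)

lemma poly_pderiv_A: "poly (pderiv (A w)) s = poly (pderiv P) s - w * poly (pderiv R) s"
  by (simp add: A_def pderiv_diff pderiv_smult)

lemma degree_le_d: "degree p \<le> d" "degree q \<le> d"
  using deg by (auto simp: rat_degree_def)

lemma q_nonzero: "q \<noteq> 0"
  using rat by (simp add: in_Rat_U_def)

lemma no_common_zero: "poly p z = 0 \<Longrightarrow> poly q z \<noteq> 0"
  using rat coprime_poly_0[of p q z] by (auto simp: in_Rat_U_def)

text \<open>The counterpart of \<open>no_common_zero\<close> at infinity: one of the two degrees is
  \<open>d\<close>.\<close>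

lemma coeff_d_nonzero: "coeff p d = 0 \<Longrightarrow> coeff q d \<noteq> 0"
  using deg q_nonzero unfolding rat_degree_def
  by (metis degree_0 leading_coeff_0_iff max_def max_0L)

lemma norm_p_less_q:
  assumes "norm z < 1"
  shows "norm (poly p z) < norm (poly q z)"
proof -
  have "rat_eval p q (Some z) \<in> Some ` UD"
    using rat assms by (simp add: in_Rat_U_def)
  then have "poly q z \<noteq> 0" "norm (poly p z / poly q z) < 1"
    by (auto simp: rat_eval_def split: if_splits)
  then show ?thesis by (simp add: norm_divide)
qed

lemma norm_p_le_q:
  assumes "norm z \<le> 1"
  shows "norm (poly p z) \<le> norm (poly q z)"
proof -
  have "continuous_on (closure UD) (\<lambda>z. norm (poly p z) - norm (poly q z))"
    by (intro continuous_intros)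
  moreover have "z \<in> closure UD" using assms by simp
  ultimately have "norm (poly p z) - norm (poly q z) \<le> 0"
  proof (rule continuous_le_on_closure[of UD "\<lambda>z. norm (poly p z) - norm (poly q z)"])
    fix x :: complex assume "x \<in> UD"
    then show "norm (poly p x) - norm (poly q x) \<le> 0"
      using norm_p_less_q[of x] by simp
  qed
  then show ?thesis by simp
qed

text \<open>By \<open>norm_p_le_q\<close> a zero of \<open>q\<close> in the closed disc would be a
  zero of \<open>p\<close> too, against coprimality.\<close>

lemma poly_q_nonzero: "norm z \<le> 1 \<Longrightarrow> poly q z \<noteq> 0"
  using norm_p_le_q[of z] no_common_zero[of z] by auto

lemma rat_fun_UD: "norm z < 1 \<Longrightarrow> norm (rat_fun p q z) < 1"
  using norm_p_less_q[of z] poly_q_nonzero[of z] by (simp add: rat_fun_def norm_divide)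

lemma rat_fun_holomorphic: "rat_fun p q holomorphic_on UD"
  unfolding rat_fun_def[abs_def] using poly_q_nonzero
  by (intro holomorphic_intros) (auto simp: poly_holomorphic_on)

section \<open>Number and location of the roots of \<open>A w\<close>\<close>

lemma coeff_A_d:
  "coeff (A w) d = cnj (poly q 0) * (1 - w * cnj (rat_fun p q 0))"
  using poly_q_nonzero[of 0]
  by (simp add: A_def P_def R_def coeff_conj_reflect rat_fun_def poly_0_coeff_0 field_simps)

text \<open>The exterior map sends infinity to the reflection of \<phi>(0), outside the closed disc.
  So infinity never belongs to the fibre over \<open>w\<close>, and the degree of \<open>A w\<close>
  does not drop.\<close>

lemma coeff_A_d_nonzero: "norm w \<le> 1 \<Longrightarrow> coeff (A w) d \<noteq> 0"
  using one_minus_mult_nonzero[of "cnj (rat_fun p q 0)" w] rat_fun_UD[of 0] poly_q_nonzero[of 0]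
  by (simp add: coeff_A_d mult.commute)

lemma degree_A: "norm w \<le> 1 \<Longrightarrow> degree (A w) = d"
proof (rule antisym)
  show "degree (A w) \<le> d"
    unfolding A_def P_def R_def
    by (meson degree_diff_le degree_conj_reflect degree_smult_le order_trans)
qed (simp add: coeff_A_d_nonzero le_degree)

lemma A_nonzero: "norm w \<le> 1 \<Longrightarrow> A w \<noteq> 0"
  using coeff_A_d_nonzero by fastforce

text \<open>At z = 1 / cnj s, vanishing of the right side is the equation \<phi>(z) = 1 / cnj w
  cleared of denominators; this form includes \<open>w = 0\<close>, where z is a pole of
  \<phi>.\<close>

lemma poly_A_reflect:
  assumes "s \<noteq> 0"
  shows "poly (A w) s = s ^ d * cnj (poly q (1 / cnj s) - cnj w * poly p (1 / cnj s))"
  using assms by (simp add: poly_A P_def R_def poly_conj_reflect degree_le_d algebra_simps)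

lemma A_root_reflect:
  assumes "poly (A w) s = 0" "s \<noteq> 0"
  shows "poly q (1 / cnj s) = cnj w * poly p (1 / cnj s)"
proof -
  have "cnj (poly q (1 / cnj s) - cnj w * poly p (1 / cnj s)) = 0"
    using assms poly_A_reflect[of s w] by (metis mult_eq_0_iff power_not_zero)
  then show ?thesis
    by (simp only: complex_cnj_zero_iff right_minus_eq)
qed

lemma poly_A_0: "poly (A w) 0 = cnj (coeff q d) - w * cnj (coeff p d)"
  by (simp add: poly_A P_def R_def poly_conj_reflect_0)

lemma finite_A_roots: "norm w \<le> 1 \<Longrightarrow> finite {s. poly (A w) s = 0}"
  using A_nonzero by (rule poly_roots_finite)

text \<open>Reflection carries solutions to roots, with infinity going to 0. The point 0, which
  would reflect to infinity, is no solution: |\<phi>(0)| < 1, while the reflection of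
  \<open>w\<close> is outside the open disc.\<close>

lemma rat_eval_rho_imp_root:
  assumes w: "norm w \<le> 1" and x: "rat_eval p q x = rho (Some w)"
  shows "x \<noteq> Some 0" "poly (A w) (case x of None \<Rightarrow> 0 | Some z \<Rightarrow> 1 / cnj z) = 0"
proof -
  show nz: "x \<noteq> Some 0"
  proof
    assume "x = Some 0"
    then have *: "rho (Some w) = Some (rat_fun p q 0)"
      using x poly_q_nonzero[of 0] by (simp add: rat_eval_def rat_fun_def)
    then have "w \<noteq> 0" "rat_fun p q 0 = 1 / cnj w"
      by (auto simp: rho_def split: if_splits)
    then have "norm (rat_fun p q 0) * norm w = 1"
      by (simp add: norm_divide)
    moreover have "norm (rat_fun p q 0) * norm w \<le> norm (rat_fun p q 0)"
      using w by (simp add: mult_left_le)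
    ultimately show False
      using rat_fun_UD[of 0] by simp
  qed
  show "poly (A w) (case x of None \<Rightarrow> 0 | Some z \<Rightarrow> 1 / cnj z) = 0"
  proof (cases x)
    case None
    have "coeff q d = cnj w * coeff p d"
    proof (cases "w = 0")
      case True
      then have "degree p > degree q"
        using x None by (auto simp: rho_def rat_eval_def split: if_splits)
      then show ?thesis
        using True deg by (simp add: rat_degree_def coeff_eq_0)
    next
      case False
      then have "degree p = degree q" "lead_coeff p / lead_coeff q = 1 / cnj w"
        using x None by (auto simp: rho_def rat_eval_def split: if_splits)
      then show ?thesis
        using False deg q_nonzero by (simp add: rat_degree_def field_simps)
    qed
    then show ?thesis using None by (simp add: poly_A_0)
  next
    case (Some z)
    with nz have z: "z \<noteq> 0" by simp
    have "poly q z = cnj w * poly p z"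
      using x Some no_common_zero[of z]
      by (cases "w = 0"; cases "poly q z = 0") (auto simp: rho_def rat_eval_def field_simps)
    then show ?thesis
      using z Some by (simp add: poly_A_reflect)
  qed
qed

text \<open>The degree bounds the number of roots from above. For the lower bound, the reflection of
  \<open>w\<close> is a regular value of \<phi> by outer regularity, and its \<open>d\<close>
  preimages reflect injectively to roots.\<close>

lemma card_A_roots:
  assumes w: "norm w \<le> 1"
  shows "card {s. poly (A w) s = 0} = d"
proof (rule antisym)
  show "card {s. poly (A w) s = 0} \<le> d"
    using card_poly_roots_bound[OF A_nonzero[OF w]] by (simp add: degree_A w)
  define X where "X = {x. rat_eval p q x = rho (Some w)}"
  \<comment> \<open>This is \<open>rho\<close> with values in the plane. At \<open>Some 0\<close> it
    would be 1 / 0 = 0 and collide with the image of infinity; injectivity rests on that point being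
    outside \<open>X\<close>.\<close>
  define \<eta> :: "complex option \<Rightarrow> complex" where "\<eta> x = (case x of None \<Rightarrow> 0 | Some z \<Rightarrow> 1 / cnj z)" for x
  have "regular_value p q (rho (Some w))"
  proof (cases "w = 0")
    case False
    then have "1 \<le> norm (1 / cnj w)"
      using w by (simp add: norm_divide)
    then show ?thesis
      using reg False by (simp add: outer_regular_def rho_def)
  qed (use reg in \<open>simp add: outer_regular_def rho_def\<close>)
  then have "card X = d"
    by (simp add: regular_value_def X_def deg)
  moreover have "inj_on \<eta> X"
    using rat_eval_rho_imp_root(1)[OF w]
    by (auto simp: inj_on_def X_def \<eta>_def split: option.splits)
  moreover have "\<eta> ` X \<subseteq> {s. poly (A w) s = 0}"
    using rat_eval_rho_imp_root(2)[OF w] by (auto simp: X_def \<eta>_def)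
  ultimately show "d \<le> card {s. poly (A w) s = 0}"
    using card_mono[OF finite_A_roots[OF w], of "\<eta> ` X"] by (simp add: card_image)
qed

text \<open>With \<open>d\<close> distinct roots in degree \<open>d\<close>, every root is
  simple.\<close>

lemma pderiv_A_nonzero:
  assumes w: "norm w \<le> 1" and s: "poly (A w) s = 0"
  shows "poly (pderiv (A w)) s \<noteq> 0"
  using pderiv_distinct_roots[OF finite_A_roots[OF w], of "A w" s] s A_nonzero[OF w]
    finite_A_roots[OF w] coeff_A_d_nonzero[OF w]
  by (auto simp: card_A_roots degree_A w)

text \<open>A root of modulus at least 1 reflects to a point z of the closed disc with |q(z)| = |w|
  |p(z)|. This contradicts |p| \<le> |q|, since |w| < 1 and q(z) is nonzero.\<close>

lemma A_root_norm_less: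
  assumes w: "norm w < 1" and s: "poly (A w) s = 0"
  shows "norm s < 1"
proof (rule ccontr)
  assume "\<not> norm s < 1"
  then have s1: "norm s \<ge> 1" by simp
  then have s0: "s \<noteq> 0" by auto
  define z where "z = 1 / cnj s"
  have z: "norm z \<le> 1" using s1 by (simp add: z_def norm_divide divide_le_eq_1)
  have "poly q z = cnj w * poly p z"
    unfolding z_def using s s0 by (rule A_root_reflect)
  then have "norm (poly q z) = norm w * norm (poly p z)"
    by (simp add: norm_mult)
  also have "\<dots> \<le> norm w * norm (poly q z)"
    using norm_p_le_q[OF z] by (rule mult_left_mono) simp
  also have "\<dots> < norm (poly q z)"
    using w poly_q_nonzero[OF z] by simp
  finally show False by simp
qed

text \<open>For \<open>w\<close> on the circle the strict inequality comes from z instead, which now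
  lies in the open disc. The bound keeps all roots over the closed disc in a compact set.\<close>

lemma A_root_norm_le:
  assumes w: "norm w \<le> 1" and s: "poly (A w) s = 0"
  shows "norm s \<le> 1"
proof (rule ccontr)
  assume "\<not> norm s \<le> 1"
  then have s1: "norm s > 1" by simp
  then have s0: "s \<noteq> 0" by auto
  define z where "z = 1 / cnj s"
  have z: "norm z < 1" using s1 by (simp add: z_def norm_divide divide_less_eq_1)
  have "poly q z = cnj w * poly p z"
    unfolding z_def using s s0 by (rule A_root_reflect)
  then have "norm (poly q z) = norm w * norm (poly p z)"
    by (simp add: norm_mult)
  also have "\<dots> \<le> norm (poly p z)"
    using w by (simp add: mult_left_le_one_le)
  also have "\<dots> < norm (poly q z)"
    using z by (rule norm_p_less_q)
  finally show False by simp
qed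

text \<open>A common root of \<open>P\<close> and \<open>R\<close> reflects to a common zero of
  \<open>p\<close> and \<open>q\<close>; for \<open>s = 0\<close> this is a common zero at infinity,
  excluded by \<open>coeff_d_nonzero\<close>.\<close>

lemma A_root_R_nonzero:
  assumes s: "poly (A w) s = 0"
  shows "poly R s \<noteq> 0"
proof
  assume R0: "poly R s = 0"
  then have P0: "poly P s = 0" using s by (simp add: poly_A)
  show False
  proof (cases "s = 0")
    case True
    then show False
      using R0 P0 coeff_d_nonzero by (simp add: R_def P_def poly_conj_reflect_0)
  next
    case False
    then show False
      using R0 P0 no_common_zero by (simp add: R_def P_def poly_conj_reflect degree_le_d)
  qed
qed

lemma rat_ext_A_root:
  assumes s: "poly (A w) s = 0"
  shows "rat_ext p q (Some s) = Some w"
proof (cases "s = 0")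
  case True
  \<comment> \<open>The point 0 reflects to infinity, where \<phi> is read off from degrees and
    leading coefficients; \<open>w = 0\<close> means a pole there.\<close>
  have "cnj (coeff q d) = w * cnj (coeff p d)"
    using s True by (simp add: poly_A_0)
  then have eq: "coeff q d = cnj w * coeff p d"
    by (metis complex_cnj_cnj complex_cnj_mult)
  then have pd: "coeff p d \<noteq> 0" using coeff_d_nonzero by auto
  then have dp: "degree p = d"
    using degree_le_d(1) le_degree by (metis antisym)
  show ?thesis
  proof (cases "w = 0")
    case w: True
    then have "degree q < d"
      using eq degree_le_d(2) q_nonzero by (metis leading_coeff_0_iff le_neq_implies_less mult_zero_left complex_cnj_zero)
    then show ?thesis
      using True w dp by (simp add: rat_ext_def rho_def rat_eval_def)
  next
    case False
    then have "degree q = d"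
      using eq pd degree_le_d(2) le_degree[of q d] by simp
    then show ?thesis
      using True False dp eq pd by (simp add: rat_ext_def rho_def rat_eval_def)
  qed
next
  case False
  define z where "z = 1 / cnj s"
  have eq: "poly q z = cnj w * poly p z"
    unfolding z_def using s False by (rule A_root_reflect)
  then have pz: "poly p z \<noteq> 0"
    using no_common_zero[of z] by auto
  have "rho (Some s) = Some z"
    using False by (simp add: rho_def z_def)
  then show ?thesis
    using eq pz by (simp add: rat_ext_def rho_def rat_eval_def)
qed

subsection \<open>Branches of the inverse of the exterior map\<close>

text \<open>The exterior map covers the disc with \<open>d\<close> sheets. The disc is simply
  connected, so the identity lifts from each of the \<open>d\<close> points over 0; the lifts are
  holomorphic, and uniqueness of lifts keeps different ones apart at every point.\<close>

lemma exists_branches: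
  obtains \<sigma> :: "nat \<Rightarrow> complex \<Rightarrow> complex" where
    "\<And>j. j \<in> {1..d} \<Longrightarrow> \<sigma> j holomorphic_on UD"
    "\<And>j w. j \<in> {1..d} \<Longrightarrow> w \<in> UD \<Longrightarrow> poly (A w) (\<sigma> j w) = 0"
    "\<And>i j w. i \<in> {1..d} \<Longrightarrow> j \<in> {1..d} \<Longrightarrow> w \<in> UD \<Longrightarrow> \<sigma> i w = \<sigma> j w \<Longrightarrow> i = j"
proof (cases "d = 0")
  \<comment> \<open>No branch has to be found here; the covering lemma assumes positive
    \<open>d\<close>.\<close>
  case True
  then show ?thesis using that[of undefined] by simp
next
  case False
  define F where "F s = poly P s / poly R s" for s
  define E where "E = {s. poly R s \<noteq> 0} \<inter> F -` UD"
  have F_iff: "s \<in> E \<and> F s = w \<longleftrightarrow> poly (A w) s = 0" if "w \<in> UD" for s w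
    using that A_root_R_nonzero[of w s] by (auto simp: E_def F_def poly_A field_simps)
  have oR: "open {s. poly R s \<noteq> 0}"
    by (intro open_Collect_neq continuous_intros)
  have Fh: "F holomorphic_on {s. poly R s \<noteq> 0}"
    unfolding F_def by (intro holomorphic_intros) (auto simp: poly_holomorphic_on)
  have E: "open E"
    unfolding E_def
    by (intro continuous_open_preimage holomorphic_on_imp_continuous_on[OF Fh] oR open_ball)
  have FE: "F holomorphic_on E"
    using Fh by (rule holomorphic_on_subset) (auto simp: E_def)
  have dF: "deriv F s \<noteq> 0" if s: "s \<in> E" for s
  proof -
    define w where "w = F s"
    have w: "w \<in> UD" using s by (auto simp: E_def w_def)
    then have As: "poly (A w) s = 0" using F_iff[of w s] s by (simp add: w_def)
    have Rs: "poly R s \<noteq> 0" using s by (simp add: E_def)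
    have Ps: "poly P s = w * poly R s" using As by (simp add: poly_A)
    have "(F has_field_derivative
        (poly (pderiv P) s * poly R s - poly P s * poly (pderiv R) s) / (poly R s * poly R s)) (at s)"
      unfolding F_def using Rs by (intro DERIV_divide poly_DERIV)
    then have "deriv F s = (poly (pderiv P) s * poly R s - poly P s * poly (pderiv R) s) / (poly R s * poly R s)"
      by (rule DERIV_imp_deriv)
    \<comment> \<open>On the fibre P = w R, so the numerator of the quotient rule is R times the
      derivative of \<open>A w\<close>, and simplicity of the roots applies.\<close>
    also have "\<dots> = poly (pderiv (A w)) s / poly R s"
      using Rs by (simp add: Ps poly_pderiv_A field_simps)
    finally show ?thesis
      using Rs As w pderiv_A_nonzero[of w s] by simp
  qed
  have fibre: "{s \<in> E. F s = w} = {s. poly (A w) s = 0}" if "w \<in> UD" for w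
    using F_iff[OF that] by auto
  have fibre_card: "card {s \<in> E. F s = w} = d" if "w \<in> UD" for w
    using that by (simp add: fibre card_A_roots)
  have im: "F ` E = UD"
  proof
    show "F ` E \<subseteq> UD" by (auto simp: E_def)
    show "UD \<subseteq> F ` E"
    proof
      fix w :: complex assume "w \<in> UD"
      then have "{s \<in> E. F s = w} \<noteq> {}"
        using fibre_card[of w] False by (metis card.empty)
      then show "w \<in> F ` E" by blast
    qed
  qed
  have cov: "covering_space E F UD"
    by (rule covering_space_holomorphic_const_fibre[OF E FE dF open_ball im fibre_card]) (use False in auto)
  have "finite {s. poly (A 0) s = 0}" "card {s. poly (A 0) s = 0} = d"
    by (simp_all add: finite_A_roots card_A_roots)
  \<comment> \<open>The labelling of the fibre over 0 fixes the starting points of the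
    lifts.\<close>
  then obtain e where e: "bij_betw e {1..d} {s. poly (A 0) s = 0}"
    by (metis card_atLeastAtMost diff_Suc_1 finite_atLeastAtMost finite_same_card_bij)
  have "\<exists>g. continuous_on UD g \<and> g \<in> UD \<rightarrow> E \<and> g 0 = e j \<and> (\<forall>w\<in>UD. F (g w) = w)"
    if j: "j \<in> {1..d}" for j
  proof -
    have "poly (A 0) (e j) = 0"
      using e j by (auto simp: bij_betw_def)
    then have ej: "e j \<in> E" "F (e j) = 0"
      using F_iff[of 0 "e j"] by auto
    show ?thesis
    proof (rule covering_space_lift_strong[OF cov ej(1), of 0 UD "\<lambda>w. w"])
      show "simply_connected UD"
        by (simp add: convex_imp_simply_connected)
      show "locally path_connected UD"
        by (simp add: convex_imp_locally_path_connected)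
    qed (use ej in auto)
  qed
  then obtain \<sigma> where \<sigma>: "\<And>j. j \<in> {1..d} \<Longrightarrow>
      continuous_on UD (\<sigma> j) \<and> \<sigma> j \<in> UD \<rightarrow> E \<and> \<sigma> j 0 = e j \<and> (\<forall>w\<in>UD. F (\<sigma> j w) = w)"
    by metis
  show ?thesis
  proof (rule that[of \<sigma>])
    show "\<sigma> j holomorphic_on UD" if "j \<in> {1..d}" for j
      using \<sigma>[OF that]
      by (intro covering_space_lift_is_holomorphic[OF cov E FE holomorphic_on_ident]) auto
    show "poly (A w) (\<sigma> j w) = 0" if "j \<in> {1..d}" "w \<in> UD" for j w
      using \<sigma>[OF that(1)] that(2) F_iff[OF that(2), of "\<sigma> j w"] by auto
    show "i = j" if i: "i \<in> {1..d}" and j: "j \<in> {1..d}" and w: "w \<in> UD" and eq: "\<sigma> i w = \<sigma> j w" for i j w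
    proof -
      \<comment> \<open>Two lifts of the identity that meet at \<open>w\<close> agree on the
        connected disc, in particular at 0.\<close>
      have "\<sigma> i 0 = \<sigma> j 0"
        by (rule covering_space_lift_unique[where ?g1.0 = "\<sigma> i" and ?g2.0 = "\<sigma> j" and a = w
              and T = UD and f = "\<lambda>w. w", OF cov eq])
           (use \<sigma>[OF i] \<sigma>[OF j] w in auto)
      then have "e i = e j" using \<sigma>[OF i] \<sigma>[OF j] by simp
      then show ?thesis
        using e i j unfolding bij_betw_def by (blast dest: inj_onD)
    qed
  qed
qed

text \<open>The pairs (w, s) form a compact set because \<open>w\<close> ranges over the closed
  disc, so a continuous function without zeros there stays away from 0. This yields estimates
  uniform up to the unit circle.\<close>

lemma root_set_lower_bound:
  fixes h :: "complex \<times> complex \<Rightarrow> complex"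
  assumes h: "continuous_on UNIV h"
    and nz: "\<And>w s. norm w \<le> 1 \<Longrightarrow> poly (A w) s = 0 \<Longrightarrow> h (w, s) \<noteq> 0"
  obtains m where "m > 0" "\<And>w s. norm w \<le> 1 \<Longrightarrow> poly (A w) s = 0 \<Longrightarrow> m \<le> norm (h (w, s))"
proof -
  define K where "K = (cball 0 1 \<times> cball 0 1) \<inter> {x. poly P (snd x) - fst x * poly R (snd x) = 0}"
  have K: "(w, s) \<in> K" if "norm w \<le> 1" "poly (A w) s = 0" for w s
    using that A_root_norm_le[OF that] by (simp add: K_def poly_A)
  have "compact K"
    unfolding K_def
    by (intro compact_Int_closed compact_Times compact_cball closed_Collect_eq continuous_intros)
  show ?thesis
  proof (cases "K = {}")
    case True
    then show ?thesis using K by (intro that[of 1]) auto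
  next
    case False
    have "continuous_on K (\<lambda>x. norm (h x))"
      using h by (intro continuous_on_norm) (rule continuous_on_subset, auto)
    then obtain x where x: "x \<in> K" "\<And>y. y \<in> K \<Longrightarrow> norm (h x) \<le> norm (h y)"
      using continuous_attains_inf[OF \<open>compact K\<close> False] by blast
    have "norm (h x) > 0"
      using x(1) nz[of "fst x" "snd x"] by (auto simp: K_def poly_A)
    then show ?thesis
      using x K by (intro that[of "norm (h x)"]) auto
  qed
qed

text \<open>Implicit differentiation of P(\<sigma>(w)) = w R(\<sigma>(w)); simplicity of the root
  permits the division.\<close>

lemma deriv_branch:
  assumes \<sigma>: "\<sigma> holomorphic_on UD" "\<And>w. w \<in> UD \<Longrightarrow> poly (A w) (\<sigma> w) = 0" and w: "w \<in> UD"
  shows "deriv \<sigma> w = poly R (\<sigma> w) / poly (pderiv (A w)) (\<sigma> w)"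
proof -
  have ds: "(\<sigma> has_field_derivative deriv \<sigma> w) (at w)"
    using \<sigma>(1) w by (intro holomorphic_derivI[of \<sigma> UD]) auto
  have "((\<lambda>w. poly P (\<sigma> w) - w * poly R (\<sigma> w)) has_field_derivative
      poly (pderiv P) (\<sigma> w) * deriv \<sigma> w -
        (1 * poly R (\<sigma> w) + (poly (pderiv R) (\<sigma> w) * deriv \<sigma> w) * w)) (at w)"
    by (intro DERIV_diff DERIV_mult DERIV_ident DERIV_chain2[OF poly_DERIV ds])
  moreover have "((\<lambda>w. poly P (\<sigma> w) - w * poly R (\<sigma> w)) has_field_derivative 0) (at w)"
  proof (rule has_field_derivative_transform_within_open[OF _ open_ball w])
    show "((\<lambda>_. 0) has_field_derivative 0) (at w)" by simp
    show "0 = poly P (\<sigma> x) - x * poly R (\<sigma> x)" if "x \<in> UD" for x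
      using \<sigma>(2)[OF that] by (simp add: poly_A)
  qed
  ultimately have "poly (pderiv P) (\<sigma> w) * deriv \<sigma> w -
        (1 * poly R (\<sigma> w) + (poly (pderiv R) (\<sigma> w) * deriv \<sigma> w) * w) = 0"
    by (rule DERIV_unique)
  then have "deriv \<sigma> w * poly (pderiv (A w)) (\<sigma> w) = poly R (\<sigma> w)"
    by (simp add: poly_pderiv_A algebra_simps)
  moreover have "poly (pderiv (A w)) (\<sigma> w) \<noteq> 0"
    using w \<sigma>(2)[OF w] by (intro pderiv_A_nonzero) auto
  ultimately show ?thesis
    by (simp add: field_simps)
qed

text \<open>Outer regularity on the circle itself keeps the roots simple for |w| = 1, so the
  denominator in \<open>deriv_branch\<close> is bounded below by compactness.\<close>

lemma bounded_deriv_branch: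
  assumes \<sigma>: "\<sigma> holomorphic_on UD" "\<And>w. w \<in> UD \<Longrightarrow> poly (A w) (\<sigma> w) = 0"
  shows "bounded (deriv \<sigma> ` UD)"
proof -
  have "continuous_on UNIV (\<lambda>x. poly (pderiv P) (snd x) - fst x * poly (pderiv R) (snd x))"
    by (intro continuous_intros)
  then obtain m where m: "m > 0"
    "\<And>w s. norm w \<le> 1 \<Longrightarrow> poly (A w) s = 0 \<Longrightarrow> m \<le> norm (poly (pderiv (A w)) s)"
    by (rule root_set_lower_bound) (auto simp: poly_pderiv_A[symmetric] dest: pderiv_A_nonzero)
  have "bounded (poly R ` cball 0 1)"
    by (intro compact_imp_bounded compact_continuous_image continuous_intros compact_cball)
  then obtain M where M: "\<And>s. norm s \<le> 1 \<Longrightarrow> norm (poly R s) \<le> M"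
    unfolding bounded_iff by fastforce
  have "norm (deriv \<sigma> w) \<le> M / m" if w: "w \<in> UD" for w
  proof -
    have w1: "norm w \<le> 1" using w by simp
    have "norm (poly R (\<sigma> w)) \<le> M"
      by (intro M A_root_norm_le[OF w1] \<sigma>(2) w)
    moreover from this have "0 \<le> M"
      by (meson norm_ge_zero order_trans)
    moreover have "deriv \<sigma> w = poly R (\<sigma> w) / poly (pderiv (A w)) (\<sigma> w)"
      by (rule deriv_branch[OF \<sigma> w])
    ultimately show ?thesis
      using m(1) m(2)[OF w1 \<sigma>(2)[OF w]] by (simp add: norm_divide frac_le)
  qed
  then show ?thesis
    unfolding bounded_iff by blast
qed

end

section \<open>The adjoint formula with the backward shift\<close>

locale outer_regular_branches = outer_regular_map +
  fixes \<sigma> :: "nat \<Rightarrow> complex \<Rightarrow> complex"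
  assumes branch_holomorphic: "j \<in> {1..d} \<Longrightarrow> \<sigma> j holomorphic_on UD"
    and branch_root: "j \<in> {1..d} \<Longrightarrow> w \<in> UD \<Longrightarrow> poly (A w) (\<sigma> j w) = 0"
    and branch_distinct: "i \<in> {1..d} \<Longrightarrow> j \<in> {1..d} \<Longrightarrow> w \<in> UD \<Longrightarrow> \<sigma> i w = \<sigma> j w \<Longrightarrow> i = j"
begin

lemma branch_norm: "j \<in> {1..d} \<Longrightarrow> w \<in> UD \<Longrightarrow> norm (\<sigma> j w) < 1"
  using A_root_norm_less[of w "\<sigma> j w"] branch_root[of j w] by simp

lemma branch_into_UD: "j \<in> {1..d} \<Longrightarrow> \<sigma> j ` UD \<subseteq> UD"
  using branch_norm by auto

lemma deriv_branch_holomorphic: "j \<in> {1..d} \<Longrightarrow> deriv (\<sigma> j) holomorphic_on UD"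
  using branch_holomorphic by (intro holomorphic_deriv) auto

lemma branch_weight_bounded:
  assumes j: "j \<in> {1..d}"
  shows "bounded ((\<lambda>z. z * deriv (\<sigma> j) z) ` UD)"
proof -
  obtain C where C: "\<And>z. z \<in> UD \<Longrightarrow> norm (deriv (\<sigma> j) z) \<le> C"
    using bounded_deriv_branch[OF branch_holomorphic[OF j] branch_root[OF j]]
    unfolding bounded_iff by blast
  have "norm (z * deriv (\<sigma> j) z) \<le> C" if z: "z \<in> UD" for z
  proof -
    have "norm (z * deriv (\<sigma> j) z) \<le> norm (deriv (\<sigma> j) z)"
      using z by (simp add: norm_mult mult_left_le_one_le)
    then show ?thesis using C[OF z] by linarith
  qed
  then show ?thesis unfolding bounded_iff by blast
qed

text \<open>The branches list all roots of \<open>A w\<close>, and P = w R at each of them turns the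
  residue into w times the derivative of the branch.\<close>

lemma branch_partial_fractions:
  assumes w: "w \<in> UD" and y: "poly (A w) y \<noteq> 0"
  shows "poly P y / poly (A w) y =
    1 / (1 - w * cnj (rat_fun p q 0)) + (\<Sum>j\<in>{1..d}. w * deriv (\<sigma> j) w / (y - \<sigma> j w))"
proof -
  have w1: "norm w \<le> 1" using w by simp
  define Z where "Z = {s. poly (A w) s = 0}"
  have fin: "finite Z" and card: "card Z = d"
    unfolding Z_def by (simp_all add: finite_A_roots card_A_roots w1)
  have inj: "inj_on (\<lambda>j. \<sigma> j w) {1..d}"
    using branch_distinct w by (auto intro!: inj_onI)
  have Z_eq: "(\<lambda>j. \<sigma> j w) ` {1..d} = Z"
    using fin card card_image[OF inj] branch_root w
    by (intro card_subset_eq) (auto simp: Z_def)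
  have "poly P y / poly (A w) y = coeff P (degree (A w)) / lead_coeff (A w) +
      (\<Sum>s\<in>Z. poly P s / poly (pderiv (A w)) s / (y - s))"
    using fin card y A_nonzero[OF w1] degree_conj_reflect[of d q]
    by (intro partial_fractions_distinct_roots) (auto simp: Z_def degree_A w1 P_def)
  \<comment> \<open>Both coefficients of index \<open>d\<close> contain the factor
    \<open>cnj (poly q 0)\<close>, which cancels.\<close>
  also have "coeff P (degree (A w)) / lead_coeff (A w) = 1 / (1 - w * cnj (rat_fun p q 0))"
    using poly_q_nonzero[of 0]
    by (simp add: degree_A w1 coeff_A_d) (simp add: P_def coeff_conj_reflect poly_0_coeff_0)
  also have "(\<Sum>s\<in>Z. poly P s / poly (pderiv (A w)) s / (y - s)) =
      (\<Sum>j\<in>{1..d}. w * deriv (\<sigma> j) w / (y - \<sigma> j w))"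
    unfolding Z_eq[symmetric] sum.reindex[OF inj] o_def
  proof (rule sum.cong[OF refl])
    fix j assume j: "j \<in> {1..d}"
    have "deriv (\<sigma> j) w = poly R (\<sigma> j w) / poly (pderiv (A w)) (\<sigma> j w)"
      using branch_holomorphic[OF j] branch_root[OF j] w by (rule deriv_branch)
    moreover have "poly P (\<sigma> j w) = w * poly R (\<sigma> j w)"
      using branch_root[OF j w] by (simp add: poly_A)
    ultimately show "poly P (\<sigma> j w) / poly (pderiv (A w)) (\<sigma> j w) / (y - \<sigma> j w) =
        w * deriv (\<sigma> j) w / (y - \<sigma> j w)"
      by simp
  qed
  finally show ?thesis .
qed

text \<open>The expansion is taken at y = 1 / cnj z, which lies outside the closed disc and hence is
  no root, and then conjugated. At \<open>z = 0\<close>, whose reflection is infinity, the sum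
  vanishes and both sides agree.\<close>

lemma kernel_comp_partial_fractions:
  assumes w: "w \<in> UD" and z: "z \<in> UD"
  shows "1 / (1 - cnj w * rat_fun p q z) = 1 / (1 - cnj w * rat_fun p q 0) +
    (\<Sum>j\<in>{1..d}. cnj (w * deriv (\<sigma> j) w) * (z / (1 - cnj (\<sigma> j w) * z)))"
proof (cases "z = 0")
  case False
  define y where "y = 1 / cnj z"
  have y0: "y \<noteq> 0" and zy: "1 / cnj y = z"
    using False by (simp_all add: y_def)
  have "norm y > 1"
    using z False by (simp add: y_def norm_divide)
  then have Ay: "poly (A w) y \<noteq> 0"
    using A_root_norm_less[of w y] w by auto
  have qz: "poly q z \<noteq> 0" using z by (intro poly_q_nonzero) simp
  have nz: "1 - cnj w * rat_fun p q z \<noteq> 0"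
    using w z rat_fun_UD[of z] by (intro one_minus_mult_nonzero) auto
  have "poly P y = y ^ d * cnj (poly q z)"
    using y0 zy by (simp add: P_def poly_conj_reflect degree_le_d)
  moreover have "poly (A w) y = y ^ d * cnj (poly q z * (1 - cnj w * rat_fun p q z))"
  proof -
    have "poly q z * (1 - cnj w * rat_fun p q z) = poly q z - cnj w * poly p z"
      using qz by (simp add: rat_fun_def right_diff_distrib)
    then show ?thesis using poly_A_reflect[OF y0, of w] unfolding zy by simp
  qed
  ultimately have "poly P y / poly (A w) y = cnj (1 / (1 - cnj w * rat_fun p q z))"
    using y0 qz nz by simp
  then have "1 / (1 - cnj w * rat_fun p q z) = cnj (1 / (1 - w * cnj (rat_fun p q 0)) +
      (\<Sum>j\<in>{1..d}. w * deriv (\<sigma> j) w / (y - \<sigma> j w)))"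
    using branch_partial_fractions[OF w Ay] by (metis complex_cnj_cnj)
  also have "\<dots> = 1 / (1 - cnj w * rat_fun p q 0) +
      (\<Sum>j\<in>{1..d}. cnj (w * deriv (\<sigma> j) w / (y - \<sigma> j w)))"
    by simp
  also have "(\<Sum>j\<in>{1..d}. cnj (w * deriv (\<sigma> j) w / (y - \<sigma> j w))) =
      (\<Sum>j\<in>{1..d}. cnj (w * deriv (\<sigma> j) w) * (z / (1 - cnj (\<sigma> j w) * z)))"
  proof (rule sum.cong[OF refl])
    fix j
    have "cnj (y - \<sigma> j w) = (1 - cnj (\<sigma> j w) * z) / z"
      using False by (simp add: y_def field_simps)
    then show "cnj (w * deriv (\<sigma> j) w / (y - \<sigma> j w)) =
        cnj (w * deriv (\<sigma> j) w) * (z / (1 - cnj (\<sigma> j w) * z))"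
      by (simp only: complex_cnj_divide) simp
  qed
  finally show ?thesis .
qed simp

lemma bounded_comp_rat_fun: "bounded_H2_op (comp_op (rat_fun p q))"
  using rat_fun_UD by (intro bounded_comp_op rat_fun_holomorphic) auto

text \<open>Each summand of the expanded kernel is z times a geometric series, so its coefficients
  start at index 1. Pairing with \<open>g\<close> therefore meets the shifted coefficients of
  \<open>g\<close>, that is \<open>bshift g\<close> at \<open>\<sigma> j w\<close>; the constant
  term gives \<open>Lambda0\<close>.\<close>

lemma h2_inner_kernel_comp:
  assumes g: "g \<in> H2" and w: "w \<in> UD"
  shows "h2_inner g (comp_op (rat_fun p q) (\<lambda>z. 1 / (1 - cnj w * z))) =
    Lambda0 p q g w + (\<Sum>j\<in>{1..d}. w * deriv (\<sigma> j) w * bshift g (\<sigma> j w))"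
proof -
  have gh: "g holomorphic_on UD" using g by (simp add: H2_def)
  define k where "k = comp_op (rat_fun p q) (\<lambda>z. 1 / (1 - cnj w * z))"
  define c where "c = 1 / (1 - cnj w * rat_fun p q 0)"
  define a where "a n = (case n of 0 \<Rightarrow> c
      | Suc m \<Rightarrow> \<Sum>j\<in>{1..d}. cnj (w * deriv (\<sigma> j) w) * cnj (\<sigma> j w) ^ m)" for n
  have hk: "hcoef k n = a n" for n
  proof (rule hcoef_unique)
    fix z :: complex assume z: "z \<in> UD"
    have "(\<lambda>m. cnj (w * deriv (\<sigma> j) w) * (z * (cnj (\<sigma> j w) * z) ^ m)) sums
        (cnj (w * deriv (\<sigma> j) w) * (z * (1 / (1 - cnj (\<sigma> j w) * z))))" if j: "j \<in> {1..d}" for j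
    proof (intro sums_mult geometric_sums)
      show "norm (cnj (\<sigma> j w) * z) < 1"
        using branch_norm[OF j w] z mult_strict_mono[of "norm (\<sigma> j w)" 1 "norm z" 1]
        by (simp add: norm_mult)
    qed
    then have "(\<lambda>m. \<Sum>j\<in>{1..d}. cnj (w * deriv (\<sigma> j) w) * (z * (cnj (\<sigma> j w) * z) ^ m)) sums
        (\<Sum>j\<in>{1..d}. cnj (w * deriv (\<sigma> j) w) * (z * (1 / (1 - cnj (\<sigma> j w) * z))))"
      by (rule sums_sum)
    moreover have "a (Suc m) * z ^ Suc m =
        (\<Sum>j\<in>{1..d}. cnj (w * deriv (\<sigma> j) w) * (z * (cnj (\<sigma> j w) * z) ^ m))" for m
      unfolding a_def nat.case sum_distrib_right
      by (intro sum.cong refl) (simp add: power_mult_distrib mult_ac)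
    ultimately have "(\<lambda>m. a (Suc m) * z ^ Suc m) sums
        (\<Sum>j\<in>{1..d}. cnj (w * deriv (\<sigma> j) w) * (z * (1 / (1 - cnj (\<sigma> j w) * z))))"
      by (simp only:)
    from sums_Suc[OF this] show "(\<lambda>n. a n * z ^ n) sums k z"
      using kernel_comp_partial_fractions[OF w z]
      by (simp add: k_def comp_op_def a_def c_def add.commute)
  qed
  have "(\<lambda>m. w * deriv (\<sigma> j) w * (hcoef g (Suc m) * \<sigma> j w ^ m)) sums
      (w * deriv (\<sigma> j) w * bshift g (\<sigma> j w))" if j: "j \<in> {1..d}" for j
    using branch_norm[OF j w] by (intro sums_mult bshift_sums gh) simp
  then have "(\<lambda>m. \<Sum>j\<in>{1..d}. w * deriv (\<sigma> j) w * (hcoef g (Suc m) * \<sigma> j w ^ m)) sums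
      (\<Sum>j\<in>{1..d}. w * deriv (\<sigma> j) w * bshift g (\<sigma> j w))"
    by (rule sums_sum)
  moreover have "hcoef g (Suc m) * cnj (a (Suc m)) =
      (\<Sum>j\<in>{1..d}. w * deriv (\<sigma> j) w * (hcoef g (Suc m) * \<sigma> j w ^ m))" for m
    unfolding a_def nat.case cnj_sum sum_distrib_left
    by (intro sum.cong refl) (simp add: mult_ac)
  ultimately have "(\<lambda>m. hcoef g (Suc m) * cnj (a (Suc m))) sums
      (\<Sum>j\<in>{1..d}. w * deriv (\<sigma> j) w * bshift g (\<sigma> j w))"
    by (simp only:)
  from sums_Suc[OF this]
  have "(\<lambda>n. hcoef g n * cnj (hcoef k n)) sums
      ((\<Sum>j\<in>{1..d}. w * deriv (\<sigma> j) w * bshift g (\<sigma> j w)) + Lambda0 p q g w)"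
    by (simp add: hk) (simp add: a_def c_def Lambda0_def Lambda_op_def hcoef_def mult.commute)
  then show ?thesis
    by (simp add: h2_inner_def sums_iff k_def add.commute)
qed

lemma adjoint_formula_Lambda0:
  "is_H2_adjoint
     (\<lambda>f z. Lambda0 p q f z +
        (\<Sum>j\<in>{1..d}. mult_op (\<lambda>w. w * deriv (\<sigma> j) w) (comp_op (\<sigma> j) (bshift f)) z))
     (comp_op (rat_fun p q))"
  using h2_inner_kernel_comp
  by (intro is_H2_adjoint_kernelI bounded_comp_rat_fun) (simp add: mult_op_def comp_op_def)

end

section \<open>The strongly outer regular case\<close>

locale strongly_outer_regular_branches = outer_regular_branches +
  assumes strong: "strongly_outer_regular p q"
begin

text \<open>A finite value at infinity forces \<open>degree q = d\<close>. The quotient of the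
  coefficients of index \<open>d\<close> also covers \<open>degree p < d\<close>, where it is
  0.\<close>

lemma value_at_infinity:
  "coeff q d \<noteq> 0" "the (rat_eval p q None) = coeff p d / coeff q d"
  "norm (the (rat_eval p q None)) < 1"
proof -
  have inf: "rat_eval p q None \<in> Some ` UD"
    using strong by (simp add: strongly_outer_regular_def)
  then have le: "degree p \<le> degree q"
    by (auto simp: rat_eval_def split: if_splits)
  then have d: "d = degree q" by (simp add: deg rat_degree_def)
  show "coeff q d \<noteq> 0" using q_nonzero by (simp add: d)
  show "the (rat_eval p q None) = coeff p d / coeff q d"
    using le by (auto simp: rat_eval_def d coeff_eq_0)
  show "norm (the (rat_eval p q None)) < 1" using inf by auto
qed

lemma poly_A_0_eq: "poly (A w) 0 = cnj (coeff q d) * (1 - w * cnj (the (rat_eval p q None)))"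
  using value_at_infinity(1) by (simp add: poly_A_0 value_at_infinity(2) field_simps)

text \<open>The exterior map sends 0 to the reflection of \<phi>(\<infinity>), outside the closed
  disc, so 0 lies in no fibre over that disc.\<close>

lemma poly_A_0_nonzero: "norm w \<le> 1 \<Longrightarrow> poly (A w) 0 \<noteq> 0"
  using one_minus_mult_nonzero[of "cnj (the (rat_eval p q None))" w] value_at_infinity(1,3)
  by (simp add: poly_A_0_eq mult.commute)

lemma branch_nonzero: "j \<in> {1..d} \<Longrightarrow> w \<in> UD \<Longrightarrow> \<sigma> j w \<noteq> 0"
  using branch_root[of j w] poly_A_0_nonzero[of w] by auto

text \<open>Applied to the second coordinate, \<open>root_set_lower_bound\<close> keeps the branches
  at a fixed distance from 0.\<close>

lemma branch_quotient_bounded: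
  assumes j: "j \<in> {1..d}"
  shows "bounded ((\<lambda>z. z * deriv (\<sigma> j) z / \<sigma> j z) ` UD)"
proof -
  obtain C where C: "\<And>z. z \<in> UD \<Longrightarrow> norm (z * deriv (\<sigma> j) z) \<le> C"
    using branch_weight_bounded[OF j] unfolding bounded_iff by blast
  have "continuous_on UNIV (snd :: complex \<times> complex \<Rightarrow> complex)"
    by (intro continuous_intros)
  moreover have "snd (w, s) \<noteq> 0" if "norm w \<le> 1" "poly (A w) s = 0" for w s
    using that poly_A_0_nonzero by auto
  ultimately obtain m where m: "m > 0" "\<And>w s. norm w \<le> 1 \<Longrightarrow> poly (A w) s = 0 \<Longrightarrow> m \<le> norm s"
    by (rule root_set_lower_bound) auto
  have "norm (z * deriv (\<sigma> j) z / \<sigma> j z) \<le> C / m" if z: "z \<in> UD" for z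
  proof -
    have "m \<le> norm (\<sigma> j z)"
      using m(2)[of z "\<sigma> j z"] branch_root[OF j z] z by simp
    moreover have "0 \<le> C" using C[OF z] by (meson norm_ge_zero order_trans)
    ultimately show ?thesis
      unfolding norm_divide using C[OF z] m(1) by (intro frac_le)
  qed
  then show ?thesis unfolding bounded_iff by blast
qed

lemma branch_quotient_holomorphic:
  "j \<in> {1..d} \<Longrightarrow> (\<lambda>z. z * deriv (\<sigma> j) z / \<sigma> j z) holomorphic_on UD"
  using branch_nonzero
  by (intro holomorphic_intros deriv_branch_holomorphic branch_holomorphic) auto

text \<open>The partial fractions at y = 0 express the sum of the weights w \<sigma>' / \<sigma> as
  a difference of two kernels. The backward shift subtracts g(0) times this sum, which is the
  difference of \<open>Lambda0\<close> and \<open>LambdaInf\<close>.\<close>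

lemma Lambda0_eq_LambdaInf:
  assumes w: "w \<in> UD"
  shows "Lambda0 p q g w + (\<Sum>j\<in>{1..d}. w * deriv (\<sigma> j) w * bshift g (\<sigma> j w)) =
    LambdaInf p q g w + (\<Sum>j\<in>{1..d}. w * deriv (\<sigma> j) w / \<sigma> j w * g (\<sigma> j w))"
proof -
  have A0: "poly (A w) 0 \<noteq> 0" using w by (intro poly_A_0_nonzero) simp
  have "poly P 0 / poly (A w) 0 = 1 / (1 - w * cnj (the (rat_eval p q None)))"
    using value_at_infinity(1) by (simp add: poly_A_0_eq P_def poly_conj_reflect_0)
  then have *: "1 / (1 - w * cnj (the (rat_eval p q None))) =
      1 / (1 - w * cnj (rat_fun p q 0)) - (\<Sum>j\<in>{1..d}. w * deriv (\<sigma> j) w / \<sigma> j w)"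
    using branch_partial_fractions[OF w A0] by (simp add: sum_negf)
  have "w * deriv (\<sigma> j) w * bshift g (\<sigma> j w) =
      w * deriv (\<sigma> j) w / \<sigma> j w * g (\<sigma> j w) - g 0 * (w * deriv (\<sigma> j) w / \<sigma> j w)"
    if "j \<in> {1..d}" for j
    using branch_nonzero[OF that w] by (simp add: bshift_def field_simps)
  then have "(\<Sum>j\<in>{1..d}. w * deriv (\<sigma> j) w * bshift g (\<sigma> j w)) =
      (\<Sum>j\<in>{1..d}. w * deriv (\<sigma> j) w / \<sigma> j w * g (\<sigma> j w)) -
      g 0 * (\<Sum>j\<in>{1..d}. w * deriv (\<sigma> j) w / \<sigma> j w)"
    by (simp add: sum_subtractf sum_distrib_left)
  moreover have "LambdaInf p q g w = g 0 * (1 / (1 - w * cnj (the (rat_eval p q None))))"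
    by (simp add: LambdaInf_def Lambda_op_def mult.commute)
  moreover have "Lambda0 p q g w = g 0 * (1 / (1 - w * cnj (rat_fun p q 0)))"
    by (simp add: Lambda0_def Lambda_op_def mult.commute)
  ultimately show ?thesis
    unfolding * by (simp only: right_diff_distrib) simp
qed

lemma adjoint_formula_LambdaInf:
  "is_H2_adjoint
     (\<lambda>f z. LambdaInf p q f z +
        (\<Sum>j\<in>{1..d}. mult_op (\<lambda>w. w * deriv (\<sigma> j) w / \<sigma> j w) (comp_op (\<sigma> j) f) z))
     (comp_op (rat_fun p q))"
proof (intro is_H2_adjoint_kernelI bounded_comp_rat_fun)
  fix g w assume "g \<in> H2" "w \<in> UD"
  then show "h2_inner g (comp_op (rat_fun p q) (\<lambda>z. 1 / (1 - cnj w * z))) =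
      LambdaInf p q g w +
        (\<Sum>j\<in>{1..d}. mult_op (\<lambda>w. w * deriv (\<sigma> j) w / \<sigma> j w) (comp_op (\<sigma> j) g) w)"
    unfolding mult_op_def comp_op_def o_def
    using h2_inner_kernel_comp[of g w] Lambda0_eq_LambdaInf[of w g]
    by (simp only: comp_op_def o_def)
qed

end

section \<open>Both adjoint formulas for one choice of branches\<close>

theorem theorem4p5:
  fixes p q :: "complex poly" and d :: nat
  assumes rat: "in_Rat_U p q"
    and deg: "d = rat_degree p q"
  shows "outer_regular p q \<longrightarrow>
    (\<exists>\<sigma> :: nat \<Rightarrow> complex \<Rightarrow> complex.
       \<comment> \<open>(a)\<close>
       (\<forall>j\<in>{1..d}. is_branch_inv (rat_ext p q) UD (\<sigma> j) \<and> \<sigma> j ` UD \<subseteq> UD) \<and>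
       (\<forall>i\<in>{1..d}. \<forall>j\<in>{1..d}. i \<noteq> j \<longrightarrow> (\<exists>z\<in>UD. \<sigma> i z \<noteq> \<sigma> j z)) \<and>
       (\<forall>j\<in>{1..d}. (\<lambda>z. z * deriv (\<sigma> j) z) holomorphic_on UD \<and>
                    bounded ((\<lambda>z. z * deriv (\<sigma> j) z) ` UD)) \<and>
       bounded_H2_op (comp_op (rat_fun p q)) \<and>
       bounded_H2_op (Lambda0 p q) \<and>
       bounded_H2_op bshift \<and>
       (\<forall>j\<in>{1..d}. bounded_H2_op (comp_op (\<sigma> j)) \<and>
                    bounded_H2_op (mult_op (\<lambda>z. z * deriv (\<sigma> j) z))) \<and>
       is_H2_adjoint
         (\<lambda>f z. Lambda0 p q f z +
                (\<Sum>j\<in>{1..d}. mult_op (\<lambda>w. w * deriv (\<sigma> j) w) (comp_op (\<sigma> j) (bshift f)) z))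
         (comp_op (rat_fun p q)) \<and>
       \<comment> \<open>(b)\<close>
       (strongly_outer_regular p q \<longrightarrow>
          bounded_H2_op (LambdaInf p q) \<and>
          (\<forall>j\<in>{1..d}. (\<lambda>z. z * deriv (\<sigma> j) z / \<sigma> j z) holomorphic_on UD \<and>
                       bounded ((\<lambda>z. z * deriv (\<sigma> j) z / \<sigma> j z) ` UD) \<and>
                       bounded_H2_op (mult_op (\<lambda>z. z * deriv (\<sigma> j) z / \<sigma> j z))) \<and>
          is_H2_adjoint
            (\<lambda>f z. LambdaInf p q f z +
                   (\<Sum>j\<in>{1..d}. mult_op (\<lambda>w. w * deriv (\<sigma> j) w / \<sigma> j w) (comp_op (\<sigma> j) f) z))
            (comp_op (rat_fun p q))))"
proof
  assume "outer_regular p q"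
  then interpret outer_regular_map p q d
    using rat deg by unfold_locales
  obtain \<sigma> :: "nat \<Rightarrow> complex \<Rightarrow> complex" where
    \<sigma>: "\<And>j. j \<in> {1..d} \<Longrightarrow> \<sigma> j holomorphic_on UD"
    "\<And>j w. j \<in> {1..d} \<Longrightarrow> w \<in> UD \<Longrightarrow> poly (A w) (\<sigma> j w) = 0"
    "\<And>i j w. i \<in> {1..d} \<Longrightarrow> j \<in> {1..d} \<Longrightarrow> w \<in> UD \<Longrightarrow> \<sigma> i w = \<sigma> j w \<Longrightarrow> i = j"
    using exists_branches by blast
  interpret outer_regular_branches p q d \<sigma>
    by unfold_locales (fact \<sigma>)+
  have h: "(\<lambda>z. z * deriv (\<sigma> j) z) holomorphic_on UD" if "j \<in> {1..d}" for j
    using that by (intro holomorphic_intros deriv_branch_holomorphic)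
  have strong: "bounded_H2_op (LambdaInf p q) \<and>
      (\<forall>j\<in>{1..d}. (\<lambda>z. z * deriv (\<sigma> j) z / \<sigma> j z) holomorphic_on UD \<and>
         bounded ((\<lambda>z. z * deriv (\<sigma> j) z / \<sigma> j z) ` UD) \<and>
         bounded_H2_op (mult_op (\<lambda>z. z * deriv (\<sigma> j) z / \<sigma> j z))) \<and>
      is_H2_adjoint
        (\<lambda>f z. LambdaInf p q f z +
           (\<Sum>j\<in>{1..d}. mult_op (\<lambda>w. w * deriv (\<sigma> j) w / \<sigma> j w) (comp_op (\<sigma> j) f) z))
        (comp_op (rat_fun p q))" if "strongly_outer_regular p q"
  proof -
    interpret strongly_outer_regular_branches p q d \<sigma>
      using that by unfold_locales
    show ?thesis
      by (intro conjI ballI branch_quotient_holomorphic branch_quotient_bounded bounded_mult_op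
            adjoint_formula_LambdaInf)
         (use value_at_infinity(3) in \<open>simp_all add: LambdaInf_def bounded_Lambda_op\<close>)
  qed
  have "is_branch_inv (rat_ext p q) UD (\<sigma> j)" if "j \<in> {1..d}" for j
    unfolding is_branch_inv_def using that branch_holomorphic branch_root rat_ext_A_root by blast
  \<comment> \<open>The branches differ at every point of the disc, so 0 serves as witness.\<close>
  moreover have "\<exists>z\<in>UD. \<sigma> i z \<noteq> \<sigma> j z" if "i \<in> {1..d}" "j \<in> {1..d}" "i \<noteq> j" for i j
    using branch_distinct[OF that(1,2), of 0] that(3) by force
  moreover have "bounded_H2_op (Lambda0 p q)"
    unfolding Lambda0_def using rat_fun_UD[of 0] by (intro bounded_Lambda_op) simp
  ultimately show "\<exists>\<sigma> :: nat \<Rightarrow> complex \<Rightarrow> complex.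
       (\<forall>j\<in>{1..d}. is_branch_inv (rat_ext p q) UD (\<sigma> j) \<and> \<sigma> j ` UD \<subseteq> UD) \<and>
       (\<forall>i\<in>{1..d}. \<forall>j\<in>{1..d}. i \<noteq> j \<longrightarrow> (\<exists>z\<in>UD. \<sigma> i z \<noteq> \<sigma> j z)) \<and>
       (\<forall>j\<in>{1..d}. (\<lambda>z. z * deriv (\<sigma> j) z) holomorphic_on UD \<and>
                    bounded ((\<lambda>z. z * deriv (\<sigma> j) z) ` UD)) \<and>
       bounded_H2_op (comp_op (rat_fun p q)) \<and>
       bounded_H2_op (Lambda0 p q) \<and>
       bounded_H2_op bshift \<and>
       (\<forall>j\<in>{1..d}. bounded_H2_op (comp_op (\<sigma> j)) \<and>
                    bounded_H2_op (mult_op (\<lambda>z. z * deriv (\<sigma> j) z))) \<and>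
       is_H2_adjoint
         (\<lambda>f z. Lambda0 p q f z +
                (\<Sum>j\<in>{1..d}. mult_op (\<lambda>w. w * deriv (\<sigma> j) w) (comp_op (\<sigma> j) (bshift f)) z))
         (comp_op (rat_fun p q)) \<and>
       (strongly_outer_regular p q \<longrightarrow>
          bounded_H2_op (LambdaInf p q) \<and>
          (\<forall>j\<in>{1..d}. (\<lambda>z. z * deriv (\<sigma> j) z / \<sigma> j z) holomorphic_on UD \<and>
                       bounded ((\<lambda>z. z * deriv (\<sigma> j) z / \<sigma> j z) ` UD) \<and>
                       bounded_H2_op (mult_op (\<lambda>z. z * deriv (\<sigma> j) z / \<sigma> j z))) \<and>
          is_H2_adjoint
            (\<lambda>f z. LambdaInf p q f z +
                   (\<Sum>j\<in>{1..d}. mult_op (\<lambda>w. w * deriv (\<sigma> j) w / \<sigma> j w) (comp_op (\<sigma> j) f) z))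
            (comp_op (rat_fun p q)))"
    using strong
    by (intro exI[of _ \<sigma>] conjI ballI impI branch_into_UD h branch_weight_bounded
        bounded_comp_rat_fun bounded_bshift bounded_comp_op bounded_mult_op branch_holomorphic
        adjoint_formula_Lambda0) blast+
qed

end
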